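(* Let $A$ be a pro-$C^{*}$-algebra and let $E$ be a Hilbert $A$-module which is countably generated in its multiplier module $M(E)$. Then $E$ admits a standard normalised frame of multipliers, i.e. there is a sequence $\{h_n\}_{n}$ in $M(E)$ which is a standard normalised frame of multipliers in $E$.
   Context: A pro-$C^{*}$-algebra $A$ is a complete Hausdorff topological $*$-algebra over $\mathbb{C}$ whose topology is given by a directed family of $C^{*}$-seminorms; $S(A)$ is the directed set of all continuous $C^{*}$-seminorms on $A$ (no unit is assumed). A pre-Hilbert $A$-module is a complex vector space $E$ that is a right $A$-module (compatibly with the complex algebra structure) with an $A$-valued inner product $\langle\cdot,\cdot\rangle_E$, $\mathbb{C}$- and $A$-linear in the second variable, with $\langle\xi,\eta\rangle_E^{*}=\langle\eta,\xi\rangle_E$, $\langle\xi,\xi\rangle_E\ge 0$, and $\langle\xi,\xi\rangle_E=0$ iff $\xi=0$. It is a Hilbert $A$-module if it is complete for the topology given by the seminorms $\overline{p}_E(\xi)=\sqrt{p(\langle\xi,\xi\rangle_E)}$, $p\in S(A)$. $A$ itself is a Hilbert $A$-module with $\langle a,b\rangle_A=a^{*}b$. $L(E,F)$ denotes the set of adjointable module morphisms $T:E\to F$ between Hilbert $A$-modules (those having a module morphism $T^{*}:F\to E$ with $\langle T\xi,\eta\rangle_F=\langle\xi,T^{*}\eta\rangle_E$), topologized by the seminorms $\widetilde{p}_{L(E,F)}(T)=\sup\{\overline{p}_F(T\xi): \xi\in E,\ \overline{p}_E(\xi)\le 1\}$, $p\in S(A)$; $L(E)=L(E,E)$ is a pro-$C^{*}$-algebra.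 The multiplier module of $E$ is $M(E)=L(A,E)$, a Hilbert module over $M(A)=L(A)$ with action $T\cdot S=T\circ S$ and inner product $\langle T,R\rangle_{M(E)}=T^{*}\circ R$. $E$ is identified with a submodule of $M(E)$ through $\xi\mapsto(a\mapsto \xi a)$. For $h\in M(E)$, $\xi\in E$, $a\in A$: $\langle h,\xi\rangle_{M(E)}=h^{*}(\xi)\in A$, $\langle\xi,h\rangle_{M(E)}=h^{*}(\xi)^{*}$, and $h\cdot a$ is identified with $h(a)\in E$. $E$ is countably generated in $M(E)$ if there is a countable set $\{h_n\}_{n\ge1}\subseteq M(E)$ such that the closed submodule of $M(E)$ generated by $\{h_n\cdot a: a\in A,\ n=1,2,\dots\}$ is the whole of $E$. A sequence $\{h_n\}_n$ in $M(E)$ is a standard frame of multipliers in $E$ if for each $\xi\in E$ the series $\sum_n\langle\xi,h_n\rangle_{M(E)}\langle h_n,\xi\rangle_{M(E)}$ converges in $A$ and there are positive constants $C,D$ with $C\langle\xi,\xi\rangle_E\le\sum_n\langle\xi,h_n\rangle_{M(E)}\langle h_n,\xi\rangle_{M(E)}\le D\langle\xi,\xi\rangle_E$ for all $\xi\in E$. It is a standard normalised frame of multipliers if $C=D=1$. *)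

theory Defs
  imports "HOL-Analysis.Analysis"
begin

section \<open>Pro-C*-algebras\<close>

text \<open>
  Addition, multiplication and the topology of an algebra are those of its type; the complex
  scalar multiplication and the involution are collected in a record. No unit is assumed.
\<close>

record 'a star_alg =
  ascale :: "complex \<Rightarrow> 'a \<Rightarrow> 'a"
  star :: "'a \<Rightarrow> 'a"

definition cstar_seminorm :: "('a::ring, 'm) star_alg_scheme \<Rightarrow> ('a \<Rightarrow> real) \<Rightarrow> bool" where
  "cstar_seminorm A p \<longleftrightarrow>
     (\<forall>x y. p (x + y) \<le> p x + p y) \<and>
     (\<forall>c x. p (ascale A c x) = cmod c * p x) \<and>
     (\<forall>x y. p (x * y) \<le> p x * p y) \<and>
     (\<forall>x. p (star A x * x) = (p x)\<^sup>2)"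

text \<open>
  The uniform structure generated by a family of seminorms. It determines both the topology
  and the notion of Cauchy filter, hence completeness.
\<close>

definition seminorm_uniformity :: "('x::ab_group_add \<Rightarrow> real) set \<Rightarrow> ('x \<times> 'x) filter" where
  "seminorm_uniformity P = (INF p\<in>P. INF e\<in>{0<..}. principal {(x, y). p (x - y) < e})"

text \<open>
  Joint continuity of the algebraic operations is not listed among the axioms: it is automatic
  for a topology given by C*-seminorms.
\<close>

locale pro_cstar_algebra =
  fixes A :: "'a::{ring, uniform_space, t2_space} star_alg"
  assumes ascale_vector_space: "vector_space (ascale A)"
    and ascale_mult_left: "ascale A c x * y = ascale A c (x * y)"
    and ascale_mult_right: "x * ascale A c y = ascale A c (x * y)"
    and star_star: "star A (star A x) = x"
    and star_add: "star A (x + y) = star A x + star A y"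
    and star_ascale: "star A (ascale A c x) = ascale A (cnj c) (star A x)"
    and star_mult: "star A (x * y) = star A y * star A x"
    and topology_from_seminorms:
      "\<exists>P. P \<noteq> {} \<and> (\<forall>p\<in>P. cstar_seminorm A p) \<and>
           (\<forall>p\<in>P. \<forall>q\<in>P. \<exists>r\<in>P. \<forall>x. p x \<le> r x \<and> q x \<le> r x) \<and>
           (uniformity :: ('a \<times> 'a) filter) = seminorm_uniformity P"
    and complete_alg: "complete (UNIV :: 'a set)"

text \<open>The set \<open>S(A)\<close> of all continuous C*-seminorms.\<close>

definition cont_seminorms :: "('a::{ring, topological_space}, 'm) star_alg_scheme \<Rightarrow> ('a \<Rightarrow> real) set" where
  "cont_seminorms A = {p. cstar_seminorm A p \<and> continuous_on UNIV p}"

definition alg_le :: "('a::ring, 'm) star_alg_scheme \<Rightarrow> 'a \<Rightarrow> 'a \<Rightarrow> bool" where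
  "alg_le A x y \<longleftrightarrow> (\<exists>b. y - x = star A b * b)"

section \<open>Hilbert modules\<close>

record ('a, 'e) ip_module =
  mscale :: "complex \<Rightarrow> 'e \<Rightarrow> 'e"
  act :: "'e \<Rightarrow> 'a \<Rightarrow> 'e"
  ip :: "'e \<Rightarrow> 'e \<Rightarrow> 'a"

locale pre_hilbert_module = pro_cstar_algebra A
  for A :: "'a::{ring, uniform_space, t2_space} star_alg" +
  fixes E :: "('a, 'e::ab_group_add) ip_module"
  assumes mscale_vector_space: "vector_space (mscale E)"
    and act_add_left: "act E (\<xi> + \<eta>) a = act E \<xi> a + act E \<eta> a"
    and act_add_right: "act E \<xi> (a + b) = act E \<xi> a + act E \<xi> b"
    and act_mult: "act E \<xi> (a * b) = act E (act E \<xi> a) b"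
    and act_mscale: "act E (mscale E c \<xi>) a = mscale E c (act E \<xi> a)"
    and act_ascale: "act E \<xi> (ascale A c a) = mscale E c (act E \<xi> a)"
    and ip_add: "ip E \<xi> (\<eta> + \<zeta>) = ip E \<xi> \<eta> + ip E \<xi> \<zeta>"
    and ip_mscale: "ip E \<xi> (mscale E c \<eta>) = ascale A c (ip E \<xi> \<eta>)"
    and ip_act: "ip E \<xi> (act E \<eta> a) = ip E \<xi> \<eta> * a"
    and ip_star: "star A (ip E \<xi> \<eta>) = ip E \<eta> \<xi>"
    and ip_nonneg: "alg_le A 0 (ip E \<xi> \<xi>)"
    and ip_eq_0_iff: "ip E \<xi> \<xi> = 0 \<longleftrightarrow> \<xi> = 0"

definition mod_seminorm :: "('a, 'e, 'm) ip_module_scheme \<Rightarrow> ('a \<Rightarrow> real) \<Rightarrow> 'e \<Rightarrow> real" where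
  "mod_seminorm E p \<xi> = sqrt (p (ip E \<xi> \<xi>))"

locale hilbert_module = pre_hilbert_module A E
  for A :: "'a::{ring, uniform_space, t2_space} star_alg"
    and E :: "('a, 'e::{ab_group_add, uniform_space}) ip_module" +
  assumes module_topology:
      "(uniformity :: ('e \<times> 'e) filter) = seminorm_uniformity (mod_seminorm E ` cont_seminorms A)"
    and complete_module: "complete (UNIV :: 'e set)"

definition self_module :: "'a::ring star_alg \<Rightarrow> ('a, 'a) ip_module" where
  "self_module A = \<lparr>mscale = ascale A, act = (*), ip = (\<lambda>a b. star A a * b)\<rparr>"

section \<open>Adjointable maps\<close>

definition module_morphism ::
  "('a, 'e::ab_group_add) ip_module \<Rightarrow> ('a, 'f::ab_group_add) ip_module \<Rightarrow> ('e \<Rightarrow> 'f) \<Rightarrow> bool" where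
  "module_morphism E F T \<longleftrightarrow>
     Vector_Spaces.linear (mscale E) (mscale F) T \<and> (\<forall>\<xi> a. T (act E \<xi> a) = act F (T \<xi>) a)"

definition is_adjoint ::
  "('a, 'e::ab_group_add) ip_module \<Rightarrow> ('a, 'f::ab_group_add) ip_module \<Rightarrow> ('e \<Rightarrow> 'f) \<Rightarrow> ('f \<Rightarrow> 'e) \<Rightarrow> bool" where
  "is_adjoint E F T S \<longleftrightarrow> module_morphism F E S \<and> (\<forall>\<xi> \<eta>. ip F (T \<xi>) \<eta> = ip E \<xi> (S \<eta>))"

text \<open>The set \<open>L(E,F)\<close>.\<close>

definition adjointables ::
  "('a, 'e::ab_group_add) ip_module \<Rightarrow> ('a, 'f::ab_group_add) ip_module \<Rightarrow> ('e \<Rightarrow> 'f) set" where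
  "adjointables E F = {T. module_morphism E F T \<and> (\<exists>S. is_adjoint E F T S)}"

definition adj ::
  "('a, 'e::ab_group_add) ip_module \<Rightarrow> ('a, 'f::ab_group_add) ip_module \<Rightarrow> ('e \<Rightarrow> 'f) \<Rightarrow> ('f \<Rightarrow> 'e)" where
  "adj E F T = (THE S. is_adjoint E F T S)"

lemma (in pre_hilbert_module) adj_eqI:
  assumes "is_adjoint E F T S"
  shows "adj E F T = S"
  unfolding adj_def
proof (rule the_equality)
  show "is_adjoint E F T S" by fact
next
  fix S'
  assume S': "is_adjoint E F T S'"
  show "S' = S"
  proof
    fix \<eta>
    have eq: "ip E \<xi> (S' \<eta>) = ip E \<xi> (S \<eta>)" for \<xi>
      using assms S' by (metis is_adjoint_def)
    have "ip E \<xi> (S' \<eta> - S \<eta>) = 0" for \<xi>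
      using ip_add[of \<xi> "S' \<eta> - S \<eta>" "S \<eta>"] eq[of \<xi>] by simp
    then show "S' \<eta> = S \<eta>"
      using ip_eq_0_iff[of "S' \<eta> - S \<eta>"] by simp
  qed
qed

text \<open>
  The supremum is taken in the extended reals, so that it is meaningful without the theorem
  that adjointable maps are bounded for every continuous seminorm.
\<close>

definition op_seminorm ::
  "('a, 'e::ab_group_add) ip_module \<Rightarrow> ('a, 'f::ab_group_add) ip_module \<Rightarrow> ('a \<Rightarrow> real) \<Rightarrow> ('e \<Rightarrow> 'f) \<Rightarrow> ereal" where
  "op_seminorm E F p T = (SUP \<xi>\<in>{\<xi>. mod_seminorm E p \<xi> \<le> 1}. ereal (mod_seminorm F p (T \<xi>)))"

definition adjointables_topology ::
  "'a::{ring, topological_space} star_alg \<Rightarrow> ('a, 'e::ab_group_add) ip_module \<Rightarrow>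
   ('a, 'f::ab_group_add) ip_module \<Rightarrow> ('e \<Rightarrow> 'f) topology" where
  "adjointables_topology A E F = topology_generated_by
     {{R \<in> adjointables E F. op_seminorm E F p (\<lambda>\<xi>. R \<xi> - T \<xi>) < ereal \<epsilon>} | T p \<epsilon>.
        T \<in> adjointables E F \<and> p \<in> cont_seminorms A \<and> \<epsilon> > 0}"

section \<open>The multiplier module\<close>

definition multiplier_module ::
  "'a::ring star_alg \<Rightarrow> ('a, 'e::ab_group_add) ip_module \<Rightarrow> ('a \<Rightarrow> 'e) set" where
  "multiplier_module A E = adjointables (self_module A) E"

definition multiplier_embed :: "('a, 'e) ip_module \<Rightarrow> 'e \<Rightarrow> ('a \<Rightarrow> 'e)" where
  "multiplier_embed E \<xi> = (\<lambda>a. act E \<xi> a)"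

text \<open>
  Closed submodules of the Hilbert \<open>M(A)\<close>-module \<open>M(E)\<close>; the topology of \<open>M(E)\<close> is that
  of \<open>L(A,E)\<close>, and \<open>S \<in> M(A) = L(A)\<close> acts by composition on the right.
\<close>

definition closed_multiplier_submodule ::
  "'a::{ring, topological_space} star_alg \<Rightarrow> ('a, 'e::ab_group_add) ip_module \<Rightarrow> ('a \<Rightarrow> 'e) set \<Rightarrow> bool" where
  "closed_multiplier_submodule A E N \<longleftrightarrow>
     N \<subseteq> multiplier_module A E \<and>
     (\<lambda>a. 0) \<in> N \<and>
     (\<forall>R\<in>N. \<forall>T\<in>N. (\<lambda>a. R a + T a) \<in> N) \<and>
     (\<forall>c. \<forall>T\<in>N. (\<lambda>a. mscale E c (T a)) \<in> N) \<and>
     (\<forall>T\<in>N. \<forall>S\<in>adjointables (self_module A) (self_module A). T \<circ> S \<in> N) \<and>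
     closedin (adjointables_topology A (self_module A) E) N"

definition generated_closed_submodule ::
  "'a::{ring, topological_space} star_alg \<Rightarrow> ('a, 'e::ab_group_add) ip_module \<Rightarrow> ('a \<Rightarrow> 'e) set \<Rightarrow> ('a \<Rightarrow> 'e) set" where
  "generated_closed_submodule A E G = \<Inter>{N. closed_multiplier_submodule A E N \<and> G \<subseteq> N}"

text \<open>
  The element \<open>h \<cdot> a\<close> of \<open>M(E)\<close> is identified with \<open>h a \<in> E\<close>, and \<open>E\<close> with
  its image under \<open>multiplier_embed\<close>.
\<close>

definition countably_generated_in_multiplier ::
  "'a::{ring, topological_space} star_alg \<Rightarrow> ('a, 'e::ab_group_add) ip_module \<Rightarrow> bool" where
  "countably_generated_in_multiplier A E \<longleftrightarrow>
     (\<exists>H. countable H \<and> H \<subseteq> multiplier_module A E \<and>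
        generated_closed_submodule A E {multiplier_embed E (h a) | h a. h \<in> H} =
          range (multiplier_embed E))"

section \<open>Frames of multipliers\<close>

text \<open>
  For \<open>h \<in> M(E)\<close> and \<open>\<xi> \<in> E\<close>, the inner products of \<open>M(E)\<close> read
  \<open>\<langle>h, \<xi>\<rangle> = h\<^sup>*(\<xi>)\<close> and \<open>\<langle>\<xi>, h\<rangle> = h\<^sup>*(\<xi>)\<^sup>*\<close> as elements of \<open>A\<close>.
\<close>

definition mult_ip_left ::
  "'a::ring star_alg \<Rightarrow> ('a, 'e::ab_group_add) ip_module \<Rightarrow> ('a \<Rightarrow> 'e) \<Rightarrow> 'e \<Rightarrow> 'a" where
  "mult_ip_left A E h \<xi> = adj (self_module A) E h \<xi>"

definition mult_ip_right ::
  "'a::ring star_alg \<Rightarrow> ('a, 'e::ab_group_add) ip_module \<Rightarrow> 'e \<Rightarrow> ('a \<Rightarrow> 'e) \<Rightarrow> 'a" where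
  "mult_ip_right A E \<xi> h = star A (mult_ip_left A E h \<xi>)"

definition frame_with_bounds ::
  "'a::{ring, t2_space} star_alg \<Rightarrow> ('a, 'e::ab_group_add) ip_module \<Rightarrow> (nat \<Rightarrow> 'a \<Rightarrow> 'e) \<Rightarrow> real \<Rightarrow> real \<Rightarrow> bool" where
  "frame_with_bounds A E h C D \<longleftrightarrow>
     (\<forall>n. h n \<in> multiplier_module A E) \<and>
     (\<forall>\<xi>. summable (\<lambda>n. mult_ip_right A E \<xi> (h n) * mult_ip_left A E (h n) \<xi>)) \<and>
     C > 0 \<and> D > 0 \<and>
     (\<forall>\<xi>. alg_le A (ascale A (complex_of_real C) (ip E \<xi> \<xi>))
            (\<Sum>n. mult_ip_right A E \<xi> (h n) * mult_ip_left A E (h n) \<xi>) \<and>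
          alg_le A (\<Sum>n. mult_ip_right A E \<xi> (h n) * mult_ip_left A E (h n) \<xi>)
            (ascale A (complex_of_real D) (ip E \<xi> \<xi>)))"

definition standard_frame_of_multipliers ::
  "'a::{ring, t2_space} star_alg \<Rightarrow> ('a, 'e::ab_group_add) ip_module \<Rightarrow> (nat \<Rightarrow> 'a \<Rightarrow> 'e) \<Rightarrow> bool" where
  "standard_frame_of_multipliers A E h \<longleftrightarrow> (\<exists>C D. frame_with_bounds A E h C D)"

definition standard_normalised_frame_of_multipliers ::
  "'a::{ring, t2_space} star_alg \<Rightarrow> ('a, 'e::ab_group_add) ip_module \<Rightarrow> (nat \<Rightarrow> 'a \<Rightarrow> 'e) \<Rightarrow> bool" where
  "standard_normalised_frame_of_multipliers A E h \<longleftrightarrow> frame_with_bounds A E h 1 1"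

end

theory Submission
  imports Defs
begin

text \<open>
  Generating multipliers \<open>h\<close> are first made contractive: \<open>h (1 + h\<^sup>* h)\<^sup>-\<^sup>1\<close> generates the same
  submodule, and the inverse exists because everywhere defined adjointable maps are bounded for
  every seminorm. Enumerate the contractions as \<open>g\<^sub>0, g\<^sub>1, \<dots>\<close>, each of them infinitely often, and
  put \<open>R\<^sub>0 = 1\<close> and \<open>R\<^sub>j\<^sub>+\<^sub>1 = R\<^sub>j - R\<^sub>j g\<^sub>j g\<^sub>j\<^sup>* R\<^sub>j\<close>. Inductively \<open>0 \<le> R\<^sub>j \<le> 1\<close> and
  \<open>R\<^sub>j (1 + \<Sum>i<j. g\<^sub>i g\<^sub>i\<^sup>*) R\<^sub>j \<le> R\<^sub>j\<close>, so \<open>R\<^sub>j\<close> tends to \<open>0\<close> strongly on the ranges of the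
  generators, hence everywhere; as \<open>1 - R\<^sub>j = \<Sum>i<j. R\<^sub>i g\<^sub>i g\<^sub>i\<^sup>* R\<^sub>i\<close>, the multipliers \<open>R\<^sub>j g\<^sub>j\<close> form
  a normalised frame.

  All estimates rest on the monotonicity of C*-seminorms on sums of elements \<open>x\<^sup>* x\<close>. A continuous
  functional calculus is avoided: positivity of \<open>b\<close> means \<open>\<parallel>t - b\<parallel> \<le> t\<close> for some \<open>t \<ge> 0\<close>, and
  square roots are only approximate, so that no completion for a single seminorm is needed.
\<close>

section \<open>The ring of additive maps\<close>

text \<open>Elements must be built in \<open>A\<close> itself, by limits that exist in all seminorms
  at once, while estimates live in one seminorm p that may have a kernel and is not assumed
  complete. Only resolvents and one gliding sum are built as such limits. The recursion exhausts the
  identity: if 0 <= R <= 1 is the part still missing, removing R g g^* R leaves at least R - R^2 >=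
  0 because g g^* <= 1, so no inverse or root of a sum of the g g^* ever has to exist in L(E). One
  use of a generator need not exhaust its range; after n uses, n |g^* R x|^2 <= |x|^2, and for x = g
  a the decay of g^* R x controls <x, R x> = a^* g^* R x and hence R x. The hard input is the
  boundedness of multipliers. Normalising an element c for p says nothing about the other seminorms,
  so a gliding hump of such elements need not converge; the truncations c (1 + c^* c)^-1 are bounded
  by 1 in every seminorm, yet still pair well with c.\<close>

typedef (overloaded) 'a endo = "{f :: 'a::ab_group_add \<Rightarrow> 'a. \<forall>x y. f (x + y) = f x + f y}"
  morphisms app Endo
  by (rule exI[of _ id]) simp

setup_lifting type_definition_endo

text \<open>Ambient ring for the unitization. It is not a \<open>ring_1\<close>: over the trivial
  group, 0 = 1.\<close>

instantiation endo :: (ab_group_add) "{ring, monoid_mult}"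
begin

lift_definition zero_endo :: "'a endo" is "\<lambda>_. 0" by simp
lift_definition one_endo :: "'a endo" is "\<lambda>x. x" by simp
lift_definition plus_endo :: "'a endo \<Rightarrow> 'a endo \<Rightarrow> 'a endo" is "\<lambda>f g x. f x + g x"
  by (simp add: algebra_simps)
lift_definition uminus_endo :: "'a endo \<Rightarrow> 'a endo" is "\<lambda>f x. - f x" by simp
lift_definition minus_endo :: "'a endo \<Rightarrow> 'a endo \<Rightarrow> 'a endo" is "\<lambda>f g x. f x - g x"
  by (simp add: algebra_simps)
lift_definition times_endo :: "'a endo \<Rightarrow> 'a endo \<Rightarrow> 'a endo" is "\<lambda>f g x. f (g x)"
  by simp

lemma app_simps [simp]:
  "app 0 x = 0" "app 1 x = x" "app (f + g) x = app f x + app g x" "app (- f) x = - app f x"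
  "app (f - g) x = app f x - app g x" "app (f * g) x = app f (app g x)"
  by (simp_all add: zero_endo.rep_eq one_endo.rep_eq plus_endo.rep_eq uminus_endo.rep_eq
      minus_endo.rep_eq times_endo.rep_eq)

lemma app_add: "app f (x + y) = app f x + app f y"
  using app[of f] by simp

lemma endo_eqI: "(\<And>x. app f x = app g x) \<Longrightarrow> f = g"
  by (simp add: app_inject[symmetric] fun_eq_iff)

instance
  by standard (rule endo_eqI; simp add: app_add algebra_simps)+

end

section \<open>Positivity for a unital C*-seminorm\<close>

text \<open>A carrier \<open>L\<close> instead of a type, because the bounded adjointable maps
  depend on the seminorm. \<open>N\<close> may have a kernel, and even \<open>N 1\<close> may be
  0.\<close>

locale unital_cstar_seminorm =
  fixes L :: "'r::{ring, monoid_mult} set" and k :: "complex \<Rightarrow> 'r" and st :: "'r \<Rightarrow> 'r" and N :: "'r \<Rightarrow> real"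
  assumes k_in [simp, intro]: "k c \<in> L"
    and add_in [simp, intro]: "x \<in> L \<Longrightarrow> y \<in> L \<Longrightarrow> x + y \<in> L"
    and mult_in [simp, intro]: "x \<in> L \<Longrightarrow> y \<in> L \<Longrightarrow> x * y \<in> L"
    and st_in [simp, intro]: "x \<in> L \<Longrightarrow> st x \<in> L"
    and k_add: "k (c + d) = k c + k d"
    and k_mult: "k (c * d) = k c * k d"
    and k_1 [simp]: "k 1 = 1"
    and k_comm: "x \<in> L \<Longrightarrow> x * k c = k c * x"
    and st_st [simp]: "x \<in> L \<Longrightarrow> st (st x) = x"
    and st_add: "x \<in> L \<Longrightarrow> y \<in> L \<Longrightarrow> st (x + y) = st x + st y"
    and st_mult: "x \<in> L \<Longrightarrow> y \<in> L \<Longrightarrow> st (x * y) = st y * st x"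
    and st_k [simp]: "st (k c) = k (cnj c)"
    and N_add: "x \<in> L \<Longrightarrow> y \<in> L \<Longrightarrow> N (x + y) \<le> N x + N y"
    and N_mult: "x \<in> L \<Longrightarrow> y \<in> L \<Longrightarrow> N (x * y) \<le> N x * N y"
    and N_scale: "x \<in> L \<Longrightarrow> N (k c * x) = cmod c * N x"
    and N_star: "x \<in> L \<Longrightarrow> N (st x * x) = (N x)\<^sup>2"
begin

lemma k_0 [simp]: "k 0 = 0"
  using k_add[of 0 0] by simp

lemma k_uminus: "k (- c) = - k c"
  using k_add[of c "- c"] by (simp add: add_eq_0_iff)

lemma k_diff: "k (c - d) = k c - k d"
  using k_add[of c "- d"] by (simp add: k_uminus)

lemma zero_in [simp, intro]: "0 \<in> L"
  using k_in[of 0] by simp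

lemma one_in [simp, intro]: "1 \<in> L"
  using k_in[of 1] by simp

lemma uminus_eq: "- x = k (- 1) * x"
  by (simp add: k_uminus)

lemma uminus_in [simp, intro]: "x \<in> L \<Longrightarrow> - x \<in> L"
  unfolding uminus_eq by blast

lemma diff_in [simp, intro]: "x \<in> L \<Longrightarrow> y \<in> L \<Longrightarrow> x - y \<in> L"
  unfolding diff_conv_add_uminus by blast

lemma power_in [simp, intro]: "x \<in> L \<Longrightarrow> x ^ n \<in> L"
  by (induction n) auto

lemma st_1 [simp]: "st 1 = 1"
  using st_k[of 1] by simp

lemma st_uminus: "x \<in> L \<Longrightarrow> st (- x) = - st x"
  using st_add[of x "- x"] st_k[of 0] by (simp add: add_eq_0_iff)

lemma st_diff: "x \<in> L \<Longrightarrow> y \<in> L \<Longrightarrow> st (x - y) = st x - st y"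
  using st_add[of x "- y"] by (simp add: st_uminus)

lemma N_0 [simp]: "N 0 = 0"
  using N_scale[of 0 0] by simp

lemma N_uminus [simp]: "x \<in> L \<Longrightarrow> N (- x) = N x"
  using N_scale[of x "- 1"] by (simp add: k_uminus)

lemma N_minus_commute: "x \<in> L \<Longrightarrow> y \<in> L \<Longrightarrow> N (x - y) = N (y - x)"
  using N_uminus[of "x - y"] by simp

lemma N_nonneg [simp]: "x \<in> L \<Longrightarrow> 0 \<le> N x"
  using N_add[of x "- x"] by simp

lemma N_diff: "x \<in> L \<Longrightarrow> y \<in> L \<Longrightarrow> N (x - y) \<le> N x + N y"
  using N_add[of x "- y"] by simp

lemma N_triangle: "x \<in> L \<Longrightarrow> y \<in> L \<Longrightarrow> N x \<le> N y + N (x - y)"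
  using N_add[of y "x - y"] by simp

lemma N_1_le: "N 1 \<le> 1"
  using N_star[of 1] by (cases "N 1 = 0") (simp_all add: power2_eq_square)

lemma N_k_le: "N (k c) \<le> cmod c"
  using N_scale[of 1 c] mult_left_mono[OF N_1_le, of "cmod c"] by simp

lemma N_st [simp]:
  assumes "x \<in> L" shows "N (st x) = N x"
proof -
  have le: "N y \<le> N (st y)" if "y \<in> L" for y
  proof (cases "N y = 0")
    case False
    have "N y * N y \<le> N (st y) * N y"
      using N_star[OF that] N_mult[of "st y" y] that by (simp add: power2_eq_square)
    then show ?thesis
      using False N_nonneg[OF that] by simp
  qed (use that in simp)
  show ?thesis
    using le[of x] le[of "st x"] assms by simp
qed

definition rk :: "real \<Rightarrow> 'r" where
  "rk t = k (complex_of_real t)"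

lemma rk_in [simp, intro]: "rk t \<in> L"
  by (simp add: rk_def)

lemma rk_0 [simp]: "rk 0 = 0" and rk_1 [simp]: "rk 1 = 1"
  by (simp_all add: rk_def)

lemma rk_add: "rk (s + t) = rk s + rk t" and rk_diff: "rk (s - t) = rk s - rk t"
  and rk_mult: "rk (s * t) = rk s * rk t"
  by (simp_all add: rk_def k_add k_diff k_mult)

lemma rk_comm: "x \<in> L \<Longrightarrow> x * rk t = rk t * x"
  by (simp add: rk_def k_comm)

lemma rk_comm_left: "x \<in> L \<Longrightarrow> x * (rk t * y) = rk t * (x * y)"
  by (metis rk_comm mult.assoc)

lemma rk_rk: "rk s * (rk t * x) = rk (s * t) * x"
  by (simp add: rk_mult mult.assoc)

lemma rk_half: "rk (1/2) * (x + x) = x"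
proof -
  have "rk (1/2) * (x + x) = (rk (1/2) + rk (1/2)) * x" by (simp add: algebra_simps)
  also have "\<dots> = x" unfolding rk_add[symmetric] by simp
  finally show ?thesis .
qed

lemma N_rk: "x \<in> L \<Longrightarrow> N (rk t * x) = \<bar>t\<bar> * N x"
  by (simp add: rk_def N_scale)

lemma N_rk_le: "N (rk t) \<le> \<bar>t\<bar>"
  using N_k_le[of "complex_of_real t"] by (simp add: rk_def)

definition sa :: "'r \<Rightarrow> bool" where
  "sa x \<longleftrightarrow> x \<in> L \<and> st x = x"

lemma sa_in [simp, intro]: "sa x \<Longrightarrow> x \<in> L"
  by (simp add: sa_def)

lemma sa_rk [simp]: "sa (rk t)"
  by (simp add: sa_def rk_def)

lemma sa_1 [simp]: "sa 1"
  by (simp add: sa_def)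

lemma sa_0 [simp]: "sa 0"
  using sa_rk[of 0] by simp

lemma sa_add: "sa x \<Longrightarrow> sa y \<Longrightarrow> sa (x + y)"
  by (simp add: sa_def st_add)

lemma sa_diff: "sa x \<Longrightarrow> sa y \<Longrightarrow> sa (x - y)"
  by (simp add: sa_def st_diff)

lemma sa_mult: "sa x \<Longrightarrow> sa y \<Longrightarrow> x * y = y * x \<Longrightarrow> sa (x * y)"
  by (simp add: sa_def st_mult)

lemma sa_scale: "sa x \<Longrightarrow> sa (rk t * x)"
  by (rule sa_mult) (auto simp: rk_comm)

lemma sa_square: "sa x \<Longrightarrow> sa (x * x)"
  by (rule sa_mult) auto

lemma sa_star_mult: "x \<in> L \<Longrightarrow> sa (st x * x)"
  by (simp add: sa_def st_mult)

lemma N_square: "sa x \<Longrightarrow> N (x * x) = (N x)\<^sup>2"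
  using N_star[of x] by (simp add: sa_def)

text \<open>The C*-identity iterated; together with \<open>le_1_if_powers_linear\<close> it replaces
  the spectral radius formula.\<close>

lemma N_power2_power:
  assumes "sa x" shows "N (x ^ (2 ^ n)) = N x ^ (2 ^ n)"
proof -
  have "sa (x ^ (2 ^ n)) \<and> N (x ^ (2 ^ n)) = N x ^ (2 ^ n)"
  proof (induction n)
    case (Suc n)
    have e: "y ^ (2 ^ Suc n) = y ^ (2 ^ n) * y ^ (2 ^ n)" for y :: "'b::monoid_mult"
      by (simp add: power_add[symmetric] mult_2)
    show ?case
      using Suc by (simp only: e sa_square N_square power2_eq_square)
  qed (use assms in simp)
  then show ?thesis ..
qed

text \<open>The square root of 1 - y is 1 - s for a fixed point s of s = (y + s^2)/2. The iterates
  are polynomials in y, whence the commutation. The scalar iteration for y = 1 majorises them and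
  their increments; being bounded and increasing, its increments tend to 0, and the residual of 1 -
  s n is twice an increment.\<close>

lemma approx_sqrt_1:
  assumes y: "sa y" "N y \<le> 1" and e: "\<epsilon> > 0"
  obtains r where "sa r" "N (r * r - (1 - y)) \<le> \<epsilon>" "N (1 - r) \<le> 1"
    "\<And>z. z \<in> L \<Longrightarrow> z * y = y * z \<Longrightarrow> z * r = r * z"
proof -
  define s where "s = rec_nat 0 (\<lambda>_ x. rk (1/2) * (y + x * x))"
  define \<sigma> where "\<sigma> = rec_nat 0 (\<lambda>_ x. (1 + x\<^sup>2) / 2 :: real)"
  have s0: "s 0 = 0" and sS: "s (Suc n) = rk (1/2) * (y + s n * s n)" for n
    by (simp_all add: s_def)
  have \<sigma>0: "\<sigma> 0 = 0" and \<sigma>S: "\<sigma> (Suc n) = (1 + (\<sigma> n)\<^sup>2) / 2" for n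
    by (simp_all add: \<sigma>_def)
  have sa_s: "sa (s n)" for n
    by (induction n) (auto simp: s0 sS intro!: sa_scale sa_add sa_square y)
  have in_s [simp]: "s n \<in> L" for n
    using sa_s by blast
  have comm: "z * s n = s n * z" if z: "z \<in> L" "z * y = y * z" for z n
  proof (induction n)
    case (Suc n)
    have "z * (s n * s n) = (s n * s n) * z"
      by (metis Suc mult.assoc)
    then have "z * (y + s n * s n) = (y + s n * s n) * z"
      using z by (simp add: algebra_simps)
    then show ?case
      by (simp add: sS z rk_comm_left mult.assoc)
  qed (simp add: s0)
  have comm_s: "s m * s n = s n * s m" for m n
    using comm[of y n] comm[of "s n" m] y by auto
  have \<sigma>_bounds: "0 \<le> \<sigma> n \<and> \<sigma> n \<le> 1" for n
    by (induction n) (auto simp: \<sigma>0 \<sigma>S power_le_one)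
  have N_s: "N (s n) \<le> \<sigma> n" for n
  proof (induction n)
    case (Suc n)
    have "N (y + s n * s n) \<le> 1 + (\<sigma> n)\<^sup>2"
      using N_add[of y "s n * s n"] y power_mono[OF Suc, of 2] sa_s by (simp add: N_square)
    then show ?case
      by (simp add: sS \<sigma>S N_rk y)
  qed (simp add: s0 \<sigma>0)
  have N_step: "N (s (Suc n) - s n) \<le> \<sigma> (Suc n) - \<sigma> n" for n
  proof (induction n)
    case 0
    show ?case using y by (simp add: sS \<sigma>S s0 \<sigma>0 N_rk)
  next
    case (Suc n)
    have "s (Suc (Suc n)) - s (Suc n) = rk (1/2) * (s (Suc n) * s (Suc n) - s n * s n)"
      unfolding sS[of "Suc n"] sS[of n] by (simp add: right_diff_distrib[symmetric] del: right_diff_distrib)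
    also have "s (Suc n) * s (Suc n) - s n * s n = (s (Suc n) - s n) * (s (Suc n) + s n)"
      using comm_s[of n "Suc n"] by (simp add: algebra_simps)
    finally have "N (s (Suc (Suc n)) - s (Suc n)) = 1/2 * N ((s (Suc n) - s n) * (s (Suc n) + s n))"
      by (simp add: N_rk)
    also have "\<dots> \<le> 1/2 * (N (s (Suc n) - s n) * N (s (Suc n) + s n))"
      by (intro mult_left_mono N_mult) auto
    also have "\<dots> \<le> 1/2 * ((\<sigma> (Suc n) - \<sigma> n) * (\<sigma> (Suc n) + \<sigma> n))"
    proof (intro mult_left_mono mult_mono Suc)
      show "N (s (Suc n) + s n) \<le> \<sigma> (Suc n) + \<sigma> n"
        using N_add[of "s (Suc n)" "s n"] N_s[of "Suc n"] N_s[of n] by simp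
      show "0 \<le> \<sigma> (Suc n) - \<sigma> n" using order_trans[OF N_nonneg Suc] by simp
    qed auto
    also have "\<dots> = \<sigma> (Suc (Suc n)) - \<sigma> (Suc n)"
      unfolding \<sigma>S[of "Suc n"] by (subst (3) \<sigma>S) (simp add: algebra_simps power2_eq_square)
    finally show ?case .
  qed
  have "incseq \<sigma>"
  proof (rule incseq_SucI)
    show "\<sigma> n \<le> \<sigma> (Suc n)" for n
      using order_trans[OF N_nonneg N_step[of n]] by simp
  qed
  then obtain l where l: "\<sigma> \<longlonglongrightarrow> l"
    using \<sigma>_bounds incseq_convergent[of \<sigma> 1] by metis
  then have "(\<lambda>n. \<sigma> (Suc n) - \<sigma> n) \<longlonglongrightarrow> l - l"
    by (intro tendsto_diff LIMSEQ_Suc)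
  then have "eventually (\<lambda>n. \<sigma> (Suc n) - \<sigma> n < \<epsilon> / 2) sequentially"
    using e by (intro order_tendstoD) auto
  then obtain n where n: "\<sigma> (Suc n) - \<sigma> n < \<epsilon> / 2"
    by (auto simp: eventually_sequentially)
  show ?thesis
  proof (rule that[of "1 - s n"])
    show "sa (1 - s n)" using sa_s by (simp add: sa_diff)
    have "(1 - s n) * (1 - s n) - (1 - y) = (y + s n * s n) - (s n + s n)"
      by (simp add: algebra_simps)
    also have "y + s n * s n = s (Suc n) + s (Suc n)"
      unfolding sS using rk_half[of "y + s n * s n"] by (simp add: distrib_left)
    also have "\<dots> - (s n + s n) = (s (Suc n) - s n) + (s (Suc n) - s n)"
      by simp
    finally have "N ((1 - s n) * (1 - s n) - (1 - y)) \<le> N (s (Suc n) - s n) + N (s (Suc n) - s n)"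
      by (simp only:) (rule N_add; auto)
    then show "N ((1 - s n) * (1 - s n) - (1 - y)) \<le> \<epsilon>"
      using N_step[of n] n by linarith
    show "N (1 - (1 - s n)) \<le> 1" using N_s[of n] \<sigma>_bounds[of n] by simp
    show "z * (1 - s n) = (1 - s n) * z" if "z \<in> L" "z * y = y * z" for z
      using comm[OF that, of n] by (simp add: algebra_simps)
  qed
qed

text \<open>x is the real part of w = x + i r, and commutation turns the square of
  \<open>N w\<close> into the right-hand side.\<close>

lemma N_commuting_square_le:
  assumes x: "sa x" and r: "sa r" and c: "x * r = r * x"
  shows "N (x * x) \<le> N (x * x + r * r)"
proof -
  have [simp]: "x \<in> L" "r \<in> L" and [simp]: "st x = x" "st r = r"
    using x r by (auto simp: sa_def)
  define w where "w = x + k \<i> * r"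
  have w [simp]: "w \<in> L" by (simp add: w_def)
  have stw: "st w = x - k \<i> * r"
    by (simp add: w_def st_add st_mult k_uminus k_comm)
  have ii: "k \<i> * (k \<i> * z) = - z" for z
    by (simp add: mult.assoc[symmetric] k_mult[symmetric] k_uminus)
  have ci: "z * (k \<i> * y) = k \<i> * (z * y)" if "z \<in> L" for z y
    by (metis that k_comm mult.assoc)
  have "st w * w = x * x + r * r"
    unfolding stw unfolding w_def by (simp add: algebra_simps ci ii c)
  then have Nw: "(N w)\<^sup>2 = N (x * x + r * r)"
    using N_star[of w] by simp
  have "x = rk (1/2) * (w + st w)"
    using rk_half[of x] unfolding stw by (simp add: w_def)
  then have "N x = 1/2 * N (w + st w)"
    by (metis N_rk add_in st_in w abs_of_nonneg zero_le_divide_1_iff zero_le_numeral)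
  also have "\<dots> \<le> N w"
    using N_add[of w "st w"] by simp
  finally have "(N x)\<^sup>2 \<le> (N w)\<^sup>2"
    by (intro power_mono) auto
  then show ?thesis
    using Nw x by (simp add: N_square)
qed

section \<open>Positive elements and monotonicity of the seminorm\<close>

definition psd :: "'r \<Rightarrow> bool" where
  "psd b \<longleftrightarrow> sa b \<and> (\<exists>t\<ge>0. N (rk t - b) \<le> t)"

lemma psd_sa: "psd b \<Longrightarrow> sa b"
  by (simp add: psd_def)

lemma psdI: "sa b \<Longrightarrow> t \<ge> 0 \<Longrightarrow> N (rk t - b) \<le> t \<Longrightarrow> psd b"
  by (auto simp: psd_def)

lemma N_rk_diff_mono:
  assumes "b \<in> L" "N (rk t - b) \<le> \<tau>" "t \<le> t'"
  shows "N (rk t' - b) \<le> \<tau> + (t' - t)"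
proof -
  have e: "rk t' - b = rk (t' - t) + (rk t - b)"
    by (simp add: rk_diff)
  have "N (rk t' - b) \<le> N (rk (t' - t)) + N (rk t - b)"
    unfolding e by (rule N_add) (use assms in auto)
  then show ?thesis
    using N_rk_le[of "t' - t"] assms by simp
qed

lemma psd_add:
  assumes "psd a" "psd b" shows "psd (a + b)"
proof -
  obtain s t where st: "s \<ge> 0" "N (rk s - a) \<le> s" "t \<ge> 0" "N (rk t - b) \<le> t"
    using assms by (auto simp: psd_def)
  have e: "rk (s + t) - (a + b) = (rk s - a) + (rk t - b)"
    by (simp add: rk_add)
  have "N (rk (s + t) - (a + b)) \<le> N (rk s - a) + N (rk t - b)"
    unfolding e by (rule N_add) (use assms in \<open>auto dest: psd_sa\<close>)
  then show ?thesis
    using st assms by (intro psdI[of _ "s + t"]) (auto dest: psd_sa intro: sa_add)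
qed

text \<open>Writing b = t (1 - y) with y of seminorm at most 1 reduces this to
  \<open>approx_sqrt_1\<close>; the bound on 1 - r there makes the root positive again.\<close>

lemma approx_sqrt:
  assumes b: "psd b" and e: "\<epsilon> > 0"
  obtains r where "psd r" "N (r * r - b) \<le> \<epsilon>"
    "\<And>z. z \<in> L \<Longrightarrow> z * b = b * z \<Longrightarrow> z * r = r * z"
proof -
  obtain t0 where t0: "t0 \<ge> 0" "N (rk t0 - b) \<le> t0"
    using b by (auto simp: psd_def)
  have sab: "sa b" and [simp]: "b \<in> L" using b psd_sa by auto
  \<comment> \<open>The witness \<open>t0\<close> may be 0; the increment permits division by
    \<open>t\<close>.\<close>
  define t where "t = t0 + 1"
  have t: "t > 0" "N (rk t - b) \<le> t"
    using t0 N_rk_diff_mono[of b t0 t0 t] by (auto simp: t_def)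
  define y where "y = 1 - rk (1/t) * b"
  have ry: "rk t * y = rk t - b"
    using t by (simp add: y_def right_diff_distrib rk_rk)
  have "y = rk (1/t) * (rk t - b)"
    using t by (simp add: ry[symmetric] rk_rk)
  then have Ny: "N y \<le> 1"
    using t by (simp add: N_rk)
  have say: "sa y" unfolding y_def by (intro sa_diff sa_scale sab) simp
  obtain r where r: "sa r" "N (r * r - (1 - y)) \<le> \<epsilon> / t" "N (1 - r) \<le> 1"
    "\<And>z. z \<in> L \<Longrightarrow> z * y = y * z \<Longrightarrow> z * r = r * z"
    using approx_sqrt_1[OF say Ny, of "\<epsilon> / t"] e t by auto
  have [simp]: "r \<in> L" "y \<in> L" using r(1) say by auto
  show ?thesis
  proof (rule that[of "rk (sqrt t) * r"])
    have "rk (sqrt t) - rk (sqrt t) * r = rk (sqrt t) * (1 - r)"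
      by (simp add: right_diff_distrib)
    then have "N (rk (sqrt t) - rk (sqrt t) * r) \<le> sqrt t"
      using r(3) t by (simp add: N_rk)
    then show "psd (rk (sqrt t) * r)"
      using t by (intro psdI[of _ "sqrt t"] sa_scale r) auto
    have e1: "rk (sqrt t) * r * (rk (sqrt t) * r) - b = rk t * (r * r - (1 - y))"
      using t ry by (simp add: mult.assoc rk_comm_left rk_rk right_diff_distrib)
    show "N (rk (sqrt t) * r * (rk (sqrt t) * r) - b) \<le> \<epsilon>"
      unfolding e1 using r(2) t by (subst N_rk) (simp_all add: field_simps)
    fix z assume z: "z \<in> L" "z * b = b * z"
    then have "z * y = y * z"
      by (simp add: y_def left_diff_distrib right_diff_distrib rk_comm_left[OF z(1)] mult.assoc)
    then show "z * (rk (sqrt t) * r) = rk (sqrt t) * r * z"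
      using r(4)[OF z(1)] by (simp add: rk_comm_left[OF z(1)] mult.assoc)
  qed
qed

text \<open>Put y = r^2 / t and let q be an approximate root of 1 - y commuting with r. Then q^2 + y
  is close to 1, so \<open>N_commuting_square_le\<close> bounds q^2, and with it 1 - y, by about
  1.\<close>

lemma N_rk_diff_square:
  assumes r: "sa r" and t: "(N r)\<^sup>2 \<le> t" "t > 0"
  shows "N (rk t - r * r) \<le> t"
proof (rule field_le_epsilon)
  fix e :: real assume e: "e > 0"
  have [simp]: "r \<in> L" using r by auto
  define y where "y = rk (1/t) * (r * r)"
  have say: "sa y" unfolding y_def by (intro sa_scale sa_square r)
  have Ny: "N y \<le> 1" using r t by (simp add: y_def N_rk N_square)
  obtain q where q: "sa q" "N (q * q - (1 - y)) \<le> e / (2 * t)"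
    "\<And>z. z \<in> L \<Longrightarrow> z * y = y * z \<Longrightarrow> z * q = q * z"
    using approx_sqrt_1[OF say Ny, of "e / (2 * t)"] e t by auto
  have [simp]: "q \<in> L" "y \<in> L" using q(1) say by auto
  define x where "x = rk (1 / sqrt t) * r"
  have sax: "sa x" unfolding x_def by (intro sa_scale r)
  have [simp]: "x \<in> L" using sax by auto
  have xx: "x * x = y"
    using t by (simp add: x_def y_def mult.assoc rk_comm_left rk_rk)
  have "x * q = q * x"
    by (rule q(3)) (simp_all add: xx[symmetric] mult.assoc)
  then have "N (q * q) \<le> N (q * q + x * x)"
    by (intro N_commuting_square_le q sax) simp
  also have "q * q + x * x = 1 + (q * q - (1 - y))"
    by (simp add: xx)
  also have "N \<dots> \<le> N 1 + N (q * q - (1 - y))"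
    by (rule N_add) auto
  also have "\<dots> \<le> 1 + e / (2 * t)"
    using N_1_le q(2) by simp
  finally have "N (1 - y) \<le> 1 + e / (2 * t) + e / (2 * t)"
    using N_triangle[of "1 - y" "q * q"] q(2) N_minus_commute[of "1 - y" "q * q"] by simp
  moreover have e1: "rk t - r * r = rk t * (1 - y)"
    using t by (simp add: y_def right_diff_distrib rk_rk)
  ultimately show "N (rk t - r * r) \<le> t + e"
    unfolding e1 using t by (subst N_rk) (simp_all add: field_simps)
qed

lemma psd_square: "sa r \<Longrightarrow> psd (r * r)"
  using N_rk_diff_square[of r "(N r)\<^sup>2 + 1"]
  by (intro psdI[of _ "(N r)\<^sup>2 + 1"] sa_square) (auto simp: add_nonneg_pos)

text \<open>Every t above \<open>N b\<close> can serve as witness of positivity, because b is close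
  to a square and \<open>N_rk_diff_square\<close> covers squares.\<close>

lemma N_rk_diff_psd:
  assumes b: "psd b" and t: "N b \<le> t"
  shows "N (rk t - b) \<le> t"
proof (rule field_le_epsilon)
  fix e :: real assume e: "e > 0"
  obtain r where r: "psd r" "N (r * r - b) \<le> e / 3"
    using approx_sqrt[OF b, of "e / 3"] e by auto
  have [simp]: "r \<in> L" "b \<in> L" and sar: "sa r" using r(1) b psd_sa by auto
  have "0 \<le> t" using order_trans[OF N_nonneg t] by simp
  then have t': "0 < t + e / 3" using e by simp
  have "(N r)\<^sup>2 \<le> t + e / 3"
    using N_triangle[of "r * r" b] r(2) t sar by (simp add: N_square)
  then have "N (rk (t + e / 3) - r * r) \<le> t + e / 3"
    using t' by (intro N_rk_diff_square sar)
  moreover have e1: "rk t - b = (rk (t + e / 3) - r * r) + (r * r - b) - rk (e / 3)"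
    by (simp add: rk_add)
  have "N (rk t - b) \<le> N (rk (t + e / 3) - r * r) + N (r * r - b) + N (rk (e / 3))"
    unfolding e1
    using N_diff[of "(rk (t + e / 3) - r * r) + (r * r - b)" "rk (e / 3)"]
      N_add[of "rk (t + e / 3) - r * r" "r * r - b"] by (simp del: diff_add_cancel add_diff_cancel diff_add_eq add_diff_eq)
  ultimately show "N (rk t - b) \<le> t + e"
    using r(2) N_rk_le[of "e / 3"] e by simp
qed

text \<open>With m = N (x + y), both x and m - x are positive; commuting approximate roots of the
  two and \<open>N_commuting_square_le\<close> bound x by m.\<close>

lemma N_mono:
  assumes x: "psd x" and y: "psd y"
  shows "N x \<le> N (x + y)"
proof (rule field_le_epsilon)
  fix e :: real assume e: "e > 0"
  have [simp]: "x \<in> L" "y \<in> L" and sa: "sa x" "sa y" using x y psd_sa by auto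
  define m where "m = N (x + y)"
  \<comment> \<open>The witness is m: the difference from \<open>rk m\<close> is x + y
    itself.\<close>
  have "psd (rk m - (x + y))"
    by (rule psdI[of _ m]) (auto simp: m_def add.commute intro!: sa_diff sa_add sa)
  then have "psd (rk m - (x + y) + y)"
    using y by (rule psd_add)
  then have mx: "psd (rk m - x)"
    by simp
  obtain f where f: "psd f" "N (f * f - x) \<le> e / 3"
    "\<And>z. z \<in> L \<Longrightarrow> z * x = x * z \<Longrightarrow> z * f = f * z"
    using approx_sqrt[OF x, of "e / 3"] e by auto
  obtain r where r: "psd r" "N (r * r - (rk m - x)) \<le> e / 3"
    "\<And>z. z \<in> L \<Longrightarrow> z * (rk m - x) = (rk m - x) * z \<Longrightarrow> z * r = r * z"
    using approx_sqrt[OF mx, of "e / 3"] e by auto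
  have [simp]: "f \<in> L" "r \<in> L" and saf: "sa f" "sa r" using f(1) r(1) psd_sa by auto
  have "x * r = r * x"
    by (rule r(3)) (simp_all add: algebra_simps rk_comm)
  then have "r * f = f * r"
    using f(3)[of r] by simp
  then have "N (f * f) \<le> N (f * f + r * r)"
    by (intro N_commuting_square_le saf) simp
  also have "f * f + r * r = (f * f - x) + (r * r - (rk m - x)) + rk m"
    by simp
  also have "N \<dots> \<le> N (f * f - x) + N (r * r - (rk m - x)) + N (rk m)"
    using N_add[of "(f * f - x) + (r * r - (rk m - x))" "rk m"]
      N_add[of "f * f - x" "r * r - (rk m - x)"] by simp
  also have "\<dots> \<le> e / 3 + e / 3 + m"
    using f(2) r(2) N_rk_le[of m] by (simp add: m_def)
  finally show "N x \<le> N (x + y) + e"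
    using N_triangle[of x "f * f"] f(2) N_minus_commute[of x "f * f"] by (simp add: m_def)
qed

end

section \<open>Positivity of the elements \<open>st u * u\<close>\<close>

lemma le_1_if_powers_linear:
  fixes a :: real
  assumes "\<And>n. a ^ (2 ^ n) \<le> 1 + V * 2 ^ n"
  shows "a \<le> 1"
proof (rule ccontr)
  assume "\<not> a \<le> 1"
  then have a: "1 < a" by simp
  define x where "x = 1 / a"
  have x: "norm x < 1" using a by (simp add: x_def)
  have "(\<lambda>n. x ^ n + V * (of_nat n * x ^ n)) \<longlonglongrightarrow> 0 + V * 0"
    using x by (intro tendsto_intros LIMSEQ_power_zero powser_times_n_limit_0)
  then have "eventually (\<lambda>n. x ^ n + V * (real n * x ^ n) < 1) sequentially"
    by (intro order_tendstoD) auto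
  then obtain n0 where n0: "\<And>n. n \<ge> n0 \<Longrightarrow> x ^ n + V * (real n * x ^ n) < 1"
    by (auto simp: eventually_sequentially)
  define m :: nat where "m = 2 ^ n0"
  have "x ^ m + V * (real m * x ^ m) < 1"
    by (rule n0) (simp add: m_def less_imp_le)
  moreover have "x ^ m + V * (real m * x ^ m) = (1 + V * real m) / a ^ m"
    by (simp add: x_def power_divide add_divide_distrib)
  ultimately have "1 + V * real m < a ^ m"
    using a by (simp add: pos_divide_less_eq)
  then have "1 + V * 2 ^ n0 < a ^ (2 ^ n0)"
    by (simp add: m_def)
  then show False
    using assms[of n0] by simp
qed

context unital_cstar_seminorm
begin

lemma psd_scale:
  assumes "psd b" "c \<ge> 0" shows "psd (rk c * b)"
proof -
  obtain t where t: "t \<ge> 0" "N (rk t - b) \<le> t"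
    using assms by (auto simp: psd_def)
  have e: "rk (c * t) - rk c * b = rk c * (rk t - b)"
    by (simp add: right_diff_distrib rk_mult)
  have "N (rk (c * t) - rk c * b) \<le> c * t"
    unfolding e using assms t by (subst N_rk) (auto dest: psd_sa intro!: mult_left_mono)
  then show ?thesis
    using assms t by (intro psdI[of _ "c * t"] sa_scale) (auto dest: psd_sa)
qed

text \<open>Replaces the equality of the spectra of \<open>v v\<^sup>*\<close> and \<open>v\<^sup>* v\<close> away from \<open>0\<close>.\<close>

lemma N_rk_diff_swap:
  assumes v: "v \<in> L" and t: "0 < t" "t \<le> \<tau>" and le: "N (rk t - v * st v) \<le> \<tau>"
  shows "N (rk t - st v * v) \<le> \<tau>"
proof -
  define X where "X = rk t - st v * v"
  define W where "W = rk t - v * st v"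
  have [simp]: "v \<in> L" "X \<in> L" "W \<in> L" using v by (auto simp: X_def W_def)
  have \<tau>: "\<tau> > 0" using t by simp
  have saX: "sa X" unfolding X_def by (intro sa_diff sa_star_mult) auto
  \<comment> \<open>Powers of X, whose norms are sought, are traded for powers of W, whose norms are
    known.\<close>
  have XW: "X * st v = st v * W"
    by (simp add: X_def W_def algebra_simps rk_comm)
  have XWn: "X ^ n * st v = st v * W ^ n" for n
    by (induction n) (simp_all add: mult.assoc XW, simp add: XW mult.assoc[symmetric])
  have NW: "N (W ^ n) \<le> \<tau> ^ n" for n
  proof (induction n)
    case (Suc n)
    have "N (W * W ^ n) \<le> N W * N (W ^ n)" by (rule N_mult) auto
    also have "\<dots> \<le> \<tau> * \<tau> ^ n"
      using le Suc \<tau> by (intro mult_mono) (auto simp: W_def)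
    finally show ?case by simp
  qed (simp add: N_1_le)
  define V where "V = (N v)\<^sup>2"
  have V: "V \<ge> 0" by (simp add: V_def)
  \<comment> \<open>Splitting off one factor gives X^(n+1) = t X^n - v^* W^n v. Each step adds only
    one more V \<tau>^n, so the excess over \<tau>^n grows linearly and is invisible to the 2^n-th
    roots.\<close>
  have NX: "N (X ^ n) \<le> \<tau> ^ n * (1 + V / \<tau> * real n)" for n
  proof (induction n)
    case (Suc n)
    have "X ^ Suc n = X ^ n * X" by (simp add: power_commutes)
    also have "\<dots> = rk t * X ^ n - X ^ n * st v * v"
      by (subst (2) X_def) (simp add: right_diff_distrib rk_comm mult.assoc)
    also have "\<dots> = rk t * X ^ n - st v * W ^ n * v"
      by (simp add: XWn)
    finally have "N (X ^ Suc n) \<le> N (rk t * X ^ n) + N (st v * W ^ n * v)"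
      by (simp only:) (rule N_diff; auto)
    also have "N (rk t * X ^ n) \<le> \<tau> * (\<tau> ^ n * (1 + V / \<tau> * real n))"
      using t Suc by (simp add: N_rk) (intro mult_mono; simp)
    also have "N (st v * W ^ n * v) \<le> N (st v) * N (W ^ n) * N v"
      by (intro order_trans[OF N_mult] mult_right_mono N_mult) auto
    also have "\<dots> = V * N (W ^ n)"
      by (simp add: V_def power2_eq_square)
    also have "\<dots> \<le> V * \<tau> ^ n"
      using NW V by (intro mult_left_mono)
    finally show ?case
      using \<tau> by (simp add: field_simps)
  qed (simp add: N_1_le)
  have "N X / \<tau> \<le> 1"
  proof (rule le_1_if_powers_linear)
    fix n
    have "N X ^ (2 ^ n) \<le> \<tau> ^ (2 ^ n) * (1 + V / \<tau> * real (2 ^ n))"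
      using NX[of "2 ^ n"] N_power2_power[OF saX, of n] by simp
    then show "(N X / \<tau>) ^ (2 ^ n) \<le> 1 + V / \<tau> * 2 ^ n"
      using \<tau> by (simp add: power_divide pos_divide_le_eq mult.commute)
  qed
  then show ?thesis
    using \<tau> by (simp add: X_def)
qed

lemma sa_imag_part: "v \<in> L \<Longrightarrow> sa (k \<i> * (v - st v))"
  by (simp add: sa_def st_mult st_diff k_uminus k_comm algebra_simps)

text \<open>
  Kelley--Vaught: if \<open>b = u\<^sup>* u\<close> had a negative part \<open>m = \<bar>b\<bar> - b\<close>, then \<open>v = u m\<close> would satisfy
  \<open>v\<^sup>* v \<le> 0\<close>, while \<open>v\<^sup>* v + v v\<^sup>*\<close> is a sum of two squares.
\<close>

lemma psd_star_mult_approx: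
  assumes u: "u \<in> L" and \<delta>: "\<delta> > 0"
  obtains r where "psd r" "N r \<le> N (st u * u) + 1" "N (r - st u * u) \<le> \<delta>"
proof -
  define b where "b = st u * u"
  have sab: "sa b" unfolding b_def using u by (rule sa_star_mult)
  have [simp]: "u \<in> L" "b \<in> L" using u sab by auto
  \<comment> \<open>K bounds \<open>N m\<close> below, and the error estimates end in (N m)^4 <= 11
    K^3 \<epsilon>, whence the choice of \<epsilon>.\<close>
  define K where "K = 2 * N b + 1"
  have K1: "K \<ge> 1" by (simp add: K_def)
  define \<epsilon> where "\<epsilon> = min 1 (\<delta> ^ 4 / (11 * K ^ 3))"
  have \<epsilon>: "\<epsilon> > 0" "\<epsilon> \<le> 1" and \<epsilon>': "11 * K ^ 3 * \<epsilon> \<le> \<delta> ^ 4"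
  proof -
    have "11 * K ^ 3 > 0" using K1 by simp
    then show "\<epsilon> > 0" "\<epsilon> \<le> 1" "11 * K ^ 3 * \<epsilon> \<le> \<delta> ^ 4"
      using \<delta> by (auto simp: \<epsilon>_def min_def field_simps)
  qed
  \<comment> \<open>r stands for |b| and \<rho> for the root of r. Commuting with whatever commutes
    with b^2 gives b r = r b, on which the algebra below relies.\<close>
  obtain r where r: "psd r" "N (r * r - b * b) \<le> \<epsilon>"
    and r_comm: "\<And>z. z \<in> L \<Longrightarrow> z * (b * b) = (b * b) * z \<Longrightarrow> z * r = r * z"
    using approx_sqrt[OF psd_square[OF sab] \<epsilon>(1)] by blast
  obtain \<rho> where \<rho>: "psd \<rho>" "N (\<rho> * \<rho> - r) \<le> \<epsilon>"
    and \<rho>_comm: "\<And>z. z \<in> L \<Longrightarrow> z * r = r * z \<Longrightarrow> z * \<rho> = \<rho> * z"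
    using approx_sqrt[OF r(1) \<epsilon>(1)] by blast
  have sar: "sa r" "sa \<rho>" using r \<rho> psd_sa by auto
  have [simp]: "r \<in> L" "\<rho> \<in> L" using sar by auto
  have br: "b * r = r * b" by (rule r_comm) (simp_all add: mult.assoc)
  then have br': "b * (r * z) = r * (b * z)" for z by (metis mult.assoc)
  have "(N r)\<^sup>2 \<le> (N b)\<^sup>2 + \<epsilon>"
    using N_triangle[of "r * r" "b * b"] r(2) sar sab by (simp add: N_square)
  also have "\<dots> \<le> (N b + 1)\<^sup>2"
    using \<epsilon>(2) N_nonneg[OF \<open>b \<in> L\<close>] unfolding power2_sum power_one by linarith
  finally have Nr: "N r \<le> N b + 1"
    by (rule power2_le_imp_le) simp
  define m where "m = r - b"
  have sam: "sa m" unfolding m_def by (intro sa_diff sar sab)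
  have [simp]: "m \<in> L" using sam by auto
  have Nm: "N m \<le> K"
    using N_diff[of r b] Nr by (simp add: m_def K_def)
  have mr: "m * r = r * m" by (simp add: m_def algebra_simps br)
  have m\<rho>: "m * \<rho> = \<rho> * m" by (rule \<rho>_comm) (simp_all add: mr)
  then have m\<rho>': "m * (\<rho> * z) = \<rho> * (m * z)" for z by (metis mult.assoc)
  define D where "D = r * r - b * b"
  define F where "F = \<rho> * \<rho> - r"
  \<comment> \<open>The square of the self-adjoint d approximates m^2 r; it turns out to be minus
    \<open>st v * v\<close> up to \<open>\<eta>\<close>.\<close>
  define d where "d = \<rho> * m"
  have [simp]: "D \<in> L" "F \<in> L" by (auto simp: D_def F_def)
  have sad: "sa d" unfolding d_def by (intro sa_mult sar sam) (simp add: m\<rho>)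
  have [simp]: "d \<in> L" using sad by auto
  have ND: "N D \<le> \<epsilon>" and NF: "N F \<le> \<epsilon>" using r \<rho> by (simp_all add: D_def F_def)
  have Nmm: "N (m * m) \<le> K\<^sup>2"
    using Nm sam by (simp add: N_square power_mono)
  have KK: "K \<le> K\<^sup>2" using K1 by (simp add: power2_eq_square)
  have NmD: "N (m * D) \<le> K\<^sup>2 * \<epsilon>"
  proof -
    have "N (m * D) \<le> N m * N D" by (rule N_mult) auto
    also have "\<dots> \<le> K\<^sup>2 * \<epsilon>" using Nm ND KK by (intro mult_mono) auto
    finally show ?thesis .
  qed
  have NmmF: "N (m * m * F) \<le> K\<^sup>2 * \<epsilon>"
  proof -
    have "N (m * m * F) \<le> N (m * m) * N F" by (rule N_mult) auto
    also have "\<dots> \<le> K\<^sup>2 * \<epsilon>" using Nmm NF by (intro mult_mono) auto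
    finally show ?thesis .
  qed
  define v where "v = u * m"
  define \<eta> where "\<eta> = m * m * F + m * D"
  have [simp]: "v \<in> L" "\<eta> \<in> L" by (auto simp: v_def \<eta>_def)
  have N\<eta>: "N \<eta> \<le> 2 * (K\<^sup>2 * \<epsilon>)"
    using N_add[of "m * m * F" "m * D"] NmmF NmD by (simp add: \<eta>_def)
  have mmr: "m * m * r = d * d - m * m * F"
    by (simp add: F_def d_def algebra_simps m\<rho> m\<rho>')
  have "st v * v = m * (b * m)"
    using sam by (simp add: v_def st_mult sa_def b_def mult.assoc)
  also have "b * m = D - m * r"
    by (simp add: D_def m_def algebra_simps br)
  also have "m * (D - m * r) = \<eta> - d * d"
    using mmr by (simp add: \<eta>_def algebra_simps)
  finally have vv: "st v * v = \<eta> - d * d" .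
  \<comment> \<open>Up to sign, p and q are twice the real and imaginary parts of v, so p^2 + q^2 =
    2 (v v^* + v^* v). As v^* v is negative up to \<eta>, v v^* is positive up to \<eta>.\<close>
  define p where "p = v + st v"
  define q where "q = k \<i> * (v - st v)"
  have sap: "sa p" by (simp add: p_def sa_def st_add add.commute)
  have saq: "sa q" unfolding q_def by (rule sa_imag_part) simp
  have [simp]: "p \<in> L" "q \<in> L" using sap saq by auto
  have ii: "k \<i> * (k \<i> * z) = - z" for z
    by (simp add: mult.assoc[symmetric] k_mult[symmetric] k_uminus)
  have qq: "q * q = - ((v - st v) * (v - st v))"
  proof -
    have "q * q = k \<i> * ((v - st v) * k \<i>) * (v - st v)"
      by (simp add: q_def mult.assoc)
    also have "(v - st v) * k \<i> = k \<i> * (v - st v)"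
      by (rule k_comm) simp
    finally show ?thesis by (simp add: mult.assoc ii left_diff_distrib right_diff_distrib)
  qed
  have "p * p + q * q = (v * st v + st v * v) + (v * st v + st v * v)"
    unfolding qq by (simp add: p_def algebra_simps)
  then have "rk (1/2) * (p * p + q * q) = v * st v + st v * v"
    by (simp only: rk_half)
  define P where "P = rk (1/2) * (p * p + q * q) + d * d"
  have vv': "v * st v = P - \<eta>"
    using \<open>rk (1/2) * (p * p + q * q) = v * st v + st v * v\<close> vv by (simp add: P_def)
  have psdP: "psd P"
    unfolding P_def by (intro psd_add psd_scale psd_square sap saq sad) simp
  then have [simp]: "P \<in> L" using psd_sa by auto
  define t where "t = N P + 1"
  have t: "t > 0" unfolding t_def by (rule add_nonneg_pos) simp_all
  have e1: "rk t - v * st v = (rk t - P) + \<eta>" by (simp add: vv')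
  have "N (rk t - v * st v) \<le> N (rk t - P) + N \<eta>"
    unfolding e1 by (rule N_add) auto
  also have "N (rk t - P) \<le> t"
    using psdP by (rule N_rk_diff_psd) (simp add: t_def)
  finally have "N (rk t - st v * v) \<le> t + N \<eta>"
    using t by (intro N_rk_diff_swap) auto
  moreover have e2: "rk t + d * d = (rk t - st v * v) + \<eta>" by (simp add: vv)
  have "N (rk t + d * d) \<le> N (rk t - st v * v) + N \<eta>"
    unfolding e2 by (rule N_add) auto
  ultimately have le: "N (rk t + d * d) \<le> t + 2 * N \<eta>"
    by simp
  \<comment> \<open>After the swap, v^* v is almost positive, but it is -d^2 up to \<eta>. So d^2
    lies below a small scalar, and \<open>N_mono\<close> makes it small in norm.\<close>
  have "psd (rk (2 * N \<eta>) - d * d)"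
  proof (rule psdI[of _ "t + 2 * N \<eta>"])
    have e3: "rk (t + 2 * N \<eta>) - (rk (2 * N \<eta>) - d * d) = rk t + d * d"
      by (simp add: rk_add)
    show "N (rk (t + 2 * N \<eta>) - (rk (2 * N \<eta>) - d * d)) \<le> t + 2 * N \<eta>"
      unfolding e3 by (rule le)
  qed (use t in \<open>auto intro!: sa_diff sa_square sad\<close>)
  then have "N (d * d) \<le> N (d * d + (rk (2 * N \<eta>) - d * d))"
    by (intro N_mono psd_square sad)
  also have "\<dots> \<le> 2 * N \<eta>"
    using N_rk_le[of "2 * N \<eta>"] by simp
  finally have "N (d * d) \<le> 4 * (K\<^sup>2 * \<epsilon>)"
    using N\<eta> by simp
  then have Nmmr: "N (m * m * r) \<le> 5 * (K\<^sup>2 * \<epsilon>)"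
    unfolding mmr using N_diff[of "d * d" "m * m * F"] NmmF by simp
  \<comment> \<open>m^2 is 2 m r up to D, so smallness of m^2 r passes to m^3 and then to the fourth
    power of \<open>N m\<close>.\<close>
  have mm: "m * m = m * r + m * r - D"
    by (simp add: m_def D_def algebra_simps br)
  have mmm: "m * (m * m) = m * m * r + m * m * r - m * D"
    using arg_cong[OF mm, of "\<lambda>z. m * z"] by (simp add: algebra_simps)
  have "N (m * (m * m)) \<le> N (m * m * r) + N (m * m * r) + N (m * D)"
    unfolding mmm using N_diff[of "m * m * r + m * m * r" "m * D"] N_add[of "m * m * r" "m * m * r"]
    by simp
  then have Nmmm: "N (m * (m * m)) \<le> 11 * (K\<^sup>2 * \<epsilon>)"
    using Nmmr NmD by simp
  have "N m ^ 4 = N ((m * m) * (m * m))"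
    using sam by (simp add: N_square sa_square power2_eq_square power4_eq_xxxx)
  also have "\<dots> = N (m * (m * (m * m)))"
    by (simp add: mult.assoc)
  also have "\<dots> \<le> N m * N (m * (m * m))"
    by (rule N_mult) auto
  also have "\<dots> \<le> K * (11 * (K\<^sup>2 * \<epsilon>))"
    using Nm Nmmm K1 by (intro mult_mono) auto
  also have "\<dots> \<le> \<delta> ^ 4"
    using \<epsilon>' by (simp add: power3_eq_cube power2_eq_square mult_ac)
  finally have "N m \<le> \<delta>"
    using \<delta> by (simp add: power_mono_iff)
  then show ?thesis
    using that[OF r(1)] Nr by (simp add: b_def m_def)
qed

text \<open>The bound on \<open>N r\<close> in \<open>psd_star_mult_approx\<close> does not depend
  on the accuracy, so the same witness t survives the limit.\<close>

lemma psd_star_mult: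
  assumes u: "u \<in> L" shows "psd (st u * u)"
proof (rule psdI)
  show "sa (st u * u)" using u by (rule sa_star_mult)
  let ?b = "st u * u"
  show "0 \<le> N ?b + 1" using u by (simp add: add_nonneg_nonneg)
  show "N (rk (N ?b + 1) - ?b) \<le> N ?b + 1"
  proof (rule field_le_epsilon)
    fix e :: real assume "e > 0"
    then obtain r where r: "psd r" "N r \<le> N ?b + 1" "N (r - ?b) \<le> e"
      using psd_star_mult_approx[OF u] by metis
    have [simp]: "r \<in> L" "?b \<in> L" using r(1) psd_sa u by auto
    have e1: "rk (N ?b + 1) - ?b = (rk (N ?b + 1) - r) + (r - ?b)"
      by simp
    have "N (rk (N ?b + 1) - ?b) \<le> N (rk (N ?b + 1) - r) + N (r - ?b)"
      by (subst e1, rule N_add) auto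
    then show "N (rk (N ?b + 1) - ?b) \<le> N ?b + 1 + e"
      using N_rk_diff_psd[OF r(1,2)] r(3) by linarith
  qed
qed

end

section \<open>Pro-C*-algebras\<close>

context pro_cstar_algebra
begin

sublocale sc: vector_space "ascale A"
  by (rule ascale_vector_space)

lemma star_0 [simp]: "star A 0 = 0"
  using star_add[of 0 0] by simp

lemma star_uminus: "star A (- x) = - star A x"
  using star_add[of x "- x"] by (simp add: add_eq_0_iff)

lemma star_diff: "star A (x - y) = star A x - star A y"
  using star_add[of x "- y"] by (simp add: star_uminus)

declare star_star [simp]

context
  fixes p assumes p: "cstar_seminorm A p"
begin

lemma p_add: "p (x + y) \<le> p x + p y" and p_scale: "p (ascale A c x) = cmod c * p x"
  and p_mult: "p (x * y) \<le> p x * p y" and p_star_mult: "p (star A x * x) = (p x)\<^sup>2"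
  using p by (auto simp: cstar_seminorm_def)

lemma p_0: "p 0 = 0"
  using p_scale[of 0 0] by simp

lemma p_uminus: "p (- x) = p x"
  using p_scale[of "- 1" x] by simp

lemma p_nonneg: "0 \<le> p x"
  using p_add[of x "- x"] by (simp add: p_0 p_uminus)

lemma p_diff: "p (x - y) \<le> p x + p y"
  using p_add[of x "- y"] by (simp add: p_uminus)

lemma p_minus_commute: "p (x - y) = p (y - x)"
  using p_uminus[of "x - y"] by simp

lemma p_triangle: "p x \<le> p y + p (x - y)"
  using p_add[of y "x - y"] by simp

lemma p_sum: "p (sum f S) \<le> (\<Sum>i\<in>S. p (f i))"
proof (induction S rule: infinite_finite_induct)
  case (insert i S)
  then show ?case using p_add[of "f i" "sum f S"] by simp
qed (auto simp: p_0)

lemma p_star: "p (star A x) = p x"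
proof -
  have le: "p y \<le> p (star A y)" for y
  proof (cases "p y = 0")
    case False
    have "p y * p y \<le> p (star A y) * p y"
      using p_star_mult[of y] p_mult[of "star A y" y] by (simp add: power2_eq_square)
    then show ?thesis using False p_nonneg[of y] by simp
  qed (simp add: p_nonneg)
  show ?thesis using le[of x] le[of "star A x"] by simp
qed

end

section \<open>Convergence expressed by continuous C*-seminorms\<close>

abbreviation "S \<equiv> cont_seminorms A"

lemma S_cstar: "p \<in> S \<Longrightarrow> cstar_seminorm A p"
  by (simp add: cont_seminorms_def)

text \<open>Directedness turns the infimum of filters into a test by a single seminorm; that test
  makes each defining seminorm continuous, hence a member of \<open>S\<close>.\<close>

lemma defining_seminorms:
  obtains P where "P \<noteq> {}" "P \<subseteq> S"
    "\<And>Q. eventually Q (uniformity :: ('a \<times> 'a) filter) \<longleftrightarrow>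
       (\<exists>p\<in>P. \<exists>e>0. \<forall>x y. p (x - y) < e \<longrightarrow> Q (x, y))"
proof -
  obtain P where ne: "P \<noteq> {}" and cs: "\<And>p. p \<in> P \<Longrightarrow> cstar_seminorm A p"
    and dir: "\<And>p q. p \<in> P \<Longrightarrow> q \<in> P \<Longrightarrow> \<exists>r\<in>P. \<forall>x. p x \<le> r x \<and> q x \<le> r x"
    and unif: "(uniformity :: ('a \<times> 'a) filter) = seminorm_uniformity P"
    using topology_from_seminorms by metis
  define F :: "('a \<Rightarrow> real) \<Rightarrow> ('a \<times> 'a) filter"
    where "F p = (INF e\<in>{0<..}. principal {(x, y). p (x - y) < e})" for p
  have evF: "eventually Q (F p) \<longleftrightarrow> (\<exists>e>0. \<forall>x y. p (x - y) < e \<longrightarrow> Q (x, y))" for Q p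
  proof -
    have "eventually Q (F p) \<longleftrightarrow> (\<exists>e\<in>{0<..}. eventually Q (principal {(x, y). p (x - y) < e}))"
      unfolding F_def
    proof (rule eventually_INF_base)
      fix a b :: real assume "a \<in> {0<..}" "b \<in> {0<..}"
      then show "\<exists>x\<in>{0<..}. principal {(x', y). p (x' - y) < x}
          \<le> inf (principal {(x, y). p (x - y) < a}) (principal {(x, y). p (x - y) < b})"
        by (intro bexI[of _ "min a b"]) auto
    qed auto
    then show ?thesis by (auto simp: eventually_principal)
  qed
  have ev: "eventually Q (uniformity :: ('a \<times> 'a) filter) \<longleftrightarrow>
       (\<exists>p\<in>P. \<exists>e>0. \<forall>x y. p (x - y) < e \<longrightarrow> Q (x, y))" for Q
  proof -
    have "eventually Q (INF p\<in>P. F p) \<longleftrightarrow> (\<exists>p\<in>P. eventually Q (F p))"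
    proof (rule eventually_INF_base[OF ne])
      fix p q assume "p \<in> P" "q \<in> P"
      then obtain r where r: "r \<in> P" "\<And>x. p x \<le> r x" "\<And>x. q x \<le> r x"
        using dir by blast
      have "F r \<le> F p" "F r \<le> F q"
        unfolding le_filter_def evF using r(2,3) by (meson le_less_trans)+
      then have "F r \<le> inf (F p) (F q)"
        by simp
      then show "\<exists>x\<in>P. F x \<le> inf (F p) (F q)" using r(1) by blast
    qed
    then show ?thesis
      by (simp add: unif seminorm_uniformity_def F_def[symmetric] evF)
  qed
  have "p \<in> S" if "p \<in> P" for p
  proof -
    note p = cs[OF that]
    have "(p \<longlongrightarrow> p x) (nhds x)" for x
    proof (rule tendstoI)
      fix e :: real assume "e > 0"
      moreover have "dist (p y) (p x) \<le> p (x - y)" for y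
        using p_triangle[OF p, of x y] p_triangle[OF p, of y x] p_minus_commute[OF p, of x y]
        by (simp add: dist_real_def)
      ultimately show "eventually (\<lambda>y. dist (p y) (p x) < e) (nhds x)"
        unfolding eventually_nhds_uniformity ev using that
        by (intro bexI[of _ p] exI[of _ e]) (auto intro: le_less_trans)
    qed
    then have "continuous_on UNIV p"
      by (auto simp: continuous_on_def intro: tendsto_mono[OF at_within_le_nhds])
    with p show ?thesis by (simp add: cont_seminorms_def)
  qed
  with ne ev that show ?thesis by blast
qed

lemma tendsto_if_seminorms:
  assumes "\<And>p. p \<in> S \<Longrightarrow> ((\<lambda>n. p (f n - l)) \<longlongrightarrow> 0) F"
  shows "(f \<longlongrightarrow> l) F"
proof -
  obtain P where P: "P \<subseteq> S"
    and ev: "\<And>Q. eventually Q (uniformity :: ('a \<times> 'a) filter) \<longleftrightarrow>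
       (\<exists>p\<in>P. \<exists>e>0. \<forall>x y. p (x - y) < e \<longrightarrow> Q (x, y))"
    using defining_seminorms by metis
  show ?thesis
    unfolding filterlim_iff
  proof (intro allI impI)
    fix Q assume "eventually Q (nhds l)"
    then obtain p e where p: "p \<in> P" "e > 0" "\<And>y. p (l - y) < e \<Longrightarrow> Q y"
      unfolding eventually_nhds_uniformity ev by auto
    with P have pS: "p \<in> S" by auto
    have "eventually (\<lambda>n. p (f n - l) < e) F"
      using assms[OF pS] p(2) by (rule order_tendstoD)
    then show "eventually (\<lambda>n. Q (f n)) F"
      by eventually_elim (use p(3) p_minus_commute[OF S_cstar[OF pS]] in auto)
  qed
qed

text \<open>\<open>q\<close> need not belong to the defining family, so its continuity has to be
  used; translating the limit to 0 makes continuity at 0 enough.\<close>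

lemma seminorm_tendsto:
  assumes f: "(f \<longlongrightarrow> l) F" and q: "q \<in> S"
  shows "((\<lambda>n. q (f n - l)) \<longlongrightarrow> 0) F"
proof -
  obtain P where P: "P \<subseteq> S"
    and ev: "\<And>Q. eventually Q (uniformity :: ('a \<times> 'a) filter) \<longleftrightarrow>
       (\<exists>p\<in>P. \<exists>e>0. \<forall>x y. p (x - y) < e \<longrightarrow> Q (x, y))"
    using defining_seminorms by metis
  have "((\<lambda>n. f n - l) \<longlongrightarrow> 0) F"
    unfolding filterlim_iff
  proof (intro allI impI)
    fix Q assume "eventually Q (nhds (0::'a))"
    then obtain p e where p: "p \<in> P" "e > 0" "\<And>y. p (0 - y) < e \<Longrightarrow> Q y"
      unfolding eventually_nhds_uniformity ev by auto
    then have pS: "cstar_seminorm A p" using P S_cstar by auto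
    have "eventually (\<lambda>y. p (l - y) < e) (nhds l)"
      unfolding eventually_nhds_uniformity ev using p by (intro bexI[of _ p] exI[of _ e]) auto
    then have "eventually (\<lambda>n. p (l - f n) < e) F"
      using f by (auto simp: filterlim_iff)
    then show "eventually (\<lambda>n. Q (f n - l)) F"
      by eventually_elim (use p(3) in auto)
  qed
  moreover have "isCont q 0"
    using q by (simp add: cont_seminorms_def continuous_on_eq_continuous_at)
  ultimately have "((\<lambda>n. q (f n - l)) \<longlongrightarrow> q 0) F"
    by (rule isCont_tendsto_compose[rotated])
  then show ?thesis
    by (simp add: p_0[OF S_cstar[OF q]])
qed

lemma eq_0_if_seminorms:
  assumes "\<And>p. p \<in> S \<Longrightarrow> p x = 0" shows "x = 0"
proof -
  have "((\<lambda>n::nat. x) \<longlongrightarrow> 0) sequentially"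
  proof (rule tendsto_if_seminorms)
    fix p assume "p \<in> S"
    then have "p x = 0" by (rule assms)
    then show "(\<lambda>n. p (x - 0)) \<longlonglongrightarrow> 0" by simp
  qed
  then show ?thesis
    by (simp add: LIMSEQ_const_iff)
qed

lemma S_nonempty: "S \<noteq> {}"
proof -
  obtain P where "P \<noteq> {}" "P \<subseteq> S"
    by (rule defining_seminorms)
  then show ?thesis by auto
qed

text \<open>The source of all new elements: completeness of the algebra enters here, for series that
  converge absolutely in every seminorm.\<close>

lemma convergent_if_summable_seminorms:
  assumes "\<And>p. p \<in> S \<Longrightarrow> summable (\<lambda>n. p (u n))"
  obtains l where "(\<lambda>n. \<Sum>i<n. u i) \<longlonglongrightarrow> l"
proof -
  obtain P where P: "P \<subseteq> S"
    and ev: "\<And>Q. eventually Q (uniformity :: ('a \<times> 'a) filter) \<longleftrightarrow>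
       (\<exists>p\<in>P. \<exists>e>0. \<forall>x y. p (x - y) < e \<longrightarrow> Q (x, y))"
    using defining_seminorms by metis
  define f where "f n = (\<Sum>i<n. u i)" for n
  have "Cauchy f"
    unfolding Cauchy_uniform_iff
  proof (intro allI impI)
    fix Q assume "eventually Q (uniformity :: ('a \<times> 'a) filter)"
    then obtain p e where p: "p \<in> P" "e > 0" "\<And>x y. p (x - y) < e \<Longrightarrow> Q (x, y)"
      unfolding ev by auto
    then have pS: "p \<in> S" and pc: "cstar_seminorm A p" using P S_cstar by auto
    obtain M where M: "\<And>m n. m \<ge> M \<Longrightarrow> norm (\<Sum>i=m..<n. p (u i)) < e"
      using assms[OF pS] p(2) unfolding summable_Cauchy by metis
    have le: "p (f n - f m) < e" if "M \<le> m" "m \<le> n" for m n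
    proof -
      have "f n - f m = (\<Sum>i=m..<n. u i)"
        unfolding f_def using sum_diff_nat_ivl[of 0 m n u] that by (simp add: lessThan_atLeast0)
      then have "p (f n - f m) \<le> (\<Sum>i=m..<n. p (u i))"
        using p_sum[OF pc] by metis
      then show ?thesis using M[OF that(1), of n] by simp
    qed
    show "\<exists>N. \<forall>n\<ge>N. \<forall>m\<ge>N. Q (f n, f m)"
    proof (intro exI[of _ M] allI impI p(3))
      fix n m assume "M \<le> n" "M \<le> m"
      then show "p (f n - f m) < e"
        using le[of m n] le[of n m] p_minus_commute[OF pc, of "f n" "f m"]
        by (cases "m \<le> n") auto
    qed
  qed
  then have "\<exists>l. filtermap f sequentially \<le> nhds l"
    by (intro cauchy_filter_complete_converges[OF _ complete_alg])
       (auto simp: Cauchy_uniform filtermap_bot_iff)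
  then show ?thesis
    using that by (auto simp: filterlim_def f_def[abs_def])
qed

lemma star_mult_self_eq_0: "star A x * x = 0 \<longleftrightarrow> x = 0"
proof
  assume *: "star A x * x = 0"
  show "x = 0"
  proof (rule eq_0_if_seminorms)
    fix p assume "p \<in> S"
    then show "p x = 0"
      using p_star_mult[of p x] p_0[of p] S_cstar * by simp
  qed
qed simp

lemma star_mult_left_cancel:
  assumes "\<And>a. star A a * x = star A a * y" shows "x = y"
proof -
  have "star A (x - y) * (x - y) = 0"
    using assms[of "x - y"] by (simp add: right_diff_distrib)
  then show ?thesis by (simp add: star_mult_self_eq_0)
qed

text \<open>Closed under addition by construction: rewriting a sum of elements x^* x as a single one
  would take exact square roots in the algebra.\<close>

inductive_set pos where
  star_mult_self: "star A x * x \<in> pos"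
| pos_add: "x \<in> pos \<Longrightarrow> y \<in> pos \<Longrightarrow> x + y \<in> pos"

text \<open>
  The unitization of the algebra is realized inside the ring of additive maps: it acts on the
  algebra by adjointable maps that are bounded for the given seminorm.
\<close>

definition adjoint_pair :: "'a endo \<Rightarrow> 'a endo \<Rightarrow> bool" where
  "adjoint_pair T R \<longleftrightarrow> (\<forall>a b. star A (app T a) * b = star A a * app R b)"

definition bdd :: "('a \<Rightarrow> real) \<Rightarrow> 'a endo \<Rightarrow> bool" where
  "bdd p T \<longleftrightarrow> (\<exists>C\<ge>0. \<forall>a. p (app T a) \<le> C * p a)"

definition bdd_adjointables :: "('a \<Rightarrow> real) \<Rightarrow> 'a endo set" where
  "bdd_adjointables p = {T. \<exists>R. adjoint_pair T R \<and> bdd p T \<and> bdd p R}"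

definition endo_adj :: "'a endo \<Rightarrow> 'a endo" where
  "endo_adj T = (THE R. adjoint_pair T R)"

definition op_bound :: "('a \<Rightarrow> real) \<Rightarrow> 'a endo \<Rightarrow> real" where
  "op_bound p T = Inf {C. 0 \<le> C \<and> (\<forall>a. p (app T a) \<le> C * p a)}"

definition endo_scale :: "complex \<Rightarrow> 'a endo" where
  "endo_scale c = Endo (ascale A c)"

definition left_mult :: "'a \<Rightarrow> 'a endo" where
  "left_mult x = Endo (\<lambda>a. x * a)"

lemma app_endo_scale [simp]: "app (endo_scale c) a = ascale A c a"
  unfolding endo_scale_def by (subst Endo_inverse) (auto simp: sc.scale_right_distrib)

lemma app_left_mult [simp]: "app (left_mult x) a = x * a"
  unfolding left_mult_def by (subst Endo_inverse) (auto simp: distrib_left)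

lemma adjoint_pair_sym: "adjoint_pair T R \<Longrightarrow> adjoint_pair R T"
  unfolding adjoint_pair_def by (metis star_mult star_star)

lemma adjoint_pair_unique: "adjoint_pair T R \<Longrightarrow> adjoint_pair T R' \<Longrightarrow> R = R'"
  by (rule endo_eqI, rule star_mult_left_cancel) (simp add: adjoint_pair_def)

lemma endo_adj_eqI: "adjoint_pair T R \<Longrightarrow> endo_adj T = R"
  unfolding endo_adj_def using adjoint_pair_unique by blast

lemma adjoint_pair_scale: "adjoint_pair T R \<Longrightarrow> app T (ascale A c a) = ascale A c (app T a)"
proof (rule star_mult_left_cancel)
  fix b assume "adjoint_pair T R"
  then have *: "star A x * app T y = star A (app R x) * y" for x y
    using adjoint_pair_sym[of T R] by (simp add: adjoint_pair_def)
  show "star A b * app T (ascale A c a) = star A b * ascale A c (app T a)"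
    by (simp add: * ascale_mult_right)
qed

lemma adjoint_pair_add:
  "adjoint_pair T R \<Longrightarrow> adjoint_pair T' R' \<Longrightarrow> adjoint_pair (T + T') (R + R')"
  by (simp add: adjoint_pair_def star_add distrib_left distrib_right)

lemma adjoint_pair_mult:
  "adjoint_pair T R \<Longrightarrow> adjoint_pair T' R' \<Longrightarrow> adjoint_pair (T * T') (R' * R)"
  by (simp add: adjoint_pair_def)

lemma adjoint_pair_endo_scale: "adjoint_pair (endo_scale c) (endo_scale (cnj c))"
  by (simp add: adjoint_pair_def star_ascale ascale_mult_left ascale_mult_right)

lemma adjoint_pair_left_mult: "adjoint_pair (left_mult x) (left_mult (star A x))"
  by (simp add: adjoint_pair_def star_mult mult.assoc)

context
  fixes p assumes p: "cstar_seminorm A p"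
begin

lemma bddI: "0 \<le> C \<Longrightarrow> (\<And>a. p (app T a) \<le> C * p a) \<Longrightarrow> bdd p T"
  by (auto simp: bdd_def)

lemma op_bound_le: "0 \<le> C \<Longrightarrow> (\<And>a. p (app T a) \<le> C * p a) \<Longrightarrow> op_bound p T \<le> C"
  unfolding op_bound_def by (rule cInf_lower) (auto intro: bdd_belowI[of _ 0])

lemma op_bound_nonneg: "bdd p T \<Longrightarrow> 0 \<le> op_bound p T"
  unfolding op_bound_def by (rule cInf_greatest) (auto simp: bdd_def)

lemma op_bound: "bdd p T \<Longrightarrow> p (app T a) \<le> op_bound p T * p a"
proof (cases "p a = 0")
  case True
  assume "bdd p T"
  then obtain C where "p (app T a) \<le> C * p a" unfolding bdd_def by blast
  then show ?thesis using True by simp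
next
  case False
  then have pa: "p a > 0" using p_nonneg[OF p, of a] by simp
  assume "bdd p T"
  then have "p (app T a) / p a \<le> op_bound p T"
    unfolding op_bound_def using pa
    by (intro cInf_greatest) (auto simp: bdd_def pos_divide_le_eq)
  then show ?thesis using pa by (simp add: pos_divide_le_eq)
qed

lemma bdd_add: "bdd p T \<Longrightarrow> bdd p R \<Longrightarrow> bdd p (T + R)"
  and op_bound_add: "bdd p T \<Longrightarrow> bdd p R \<Longrightarrow> op_bound p (T + R) \<le> op_bound p T + op_bound p R"
proof -
  assume *: "bdd p T" "bdd p R"
  have "p (app (T + R) a) \<le> (op_bound p T + op_bound p R) * p a" for a
    using p_add[OF p, of "app T a" "app R a"] op_bound[OF *(1), of a] op_bound[OF *(2), of a]
    by (simp add: distrib_right)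
  then show "bdd p (T + R)" "op_bound p (T + R) \<le> op_bound p T + op_bound p R"
    using op_bound_nonneg * by (auto intro!: op_bound_le bddI[of "op_bound p T + op_bound p R"])
qed

lemma bdd_mult: "bdd p T \<Longrightarrow> bdd p R \<Longrightarrow> bdd p (T * R)"
  and op_bound_mult: "bdd p T \<Longrightarrow> bdd p R \<Longrightarrow> op_bound p (T * R) \<le> op_bound p T * op_bound p R"
proof -
  assume *: "bdd p T" "bdd p R"
  have "p (app (T * R) a) \<le> (op_bound p T * op_bound p R) * p a" for a
    using op_bound[OF *(1), of "app R a"]
      mult_left_mono[OF op_bound[OF *(2), of a] op_bound_nonneg[OF *(1)]]
    by (simp add: mult.assoc)
  then show "bdd p (T * R)" "op_bound p (T * R) \<le> op_bound p T * op_bound p R"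
    using op_bound_nonneg * by (auto intro!: op_bound_le bddI[of "op_bound p T * op_bound p R"])
qed

lemma bdd_endo_scale: "bdd p (endo_scale c)"
  by (rule bddI[of "cmod c"]) (simp_all add: p_scale[OF p])

lemma bdd_left_mult: "bdd p (left_mult x)"
  by (rule bddI[of "p x"]) (simp_all add: p_nonneg[OF p] p_mult[OF p])

lemma op_bound_scale_le: "bdd p T \<Longrightarrow> op_bound p (endo_scale c * T) \<le> cmod c * op_bound p T"
  using op_bound op_bound_nonneg
  by (intro op_bound_le) (auto simp: p_scale[OF p] mult.assoc intro!: mult_left_mono)

lemma op_bound_scale:
  assumes T: "bdd p T" shows "op_bound p (endo_scale c * T) = cmod c * op_bound p T"
proof (cases "c = 0")
  case True
  then have "op_bound p (endo_scale c * T) \<le> 0"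
    using op_bound_scale_le[OF T, of c] by simp
  then show ?thesis
    using True op_bound_nonneg[OF bdd_mult[OF bdd_endo_scale T]] by (simp add: antisym)
next
  case False
  have "endo_scale (inverse c) * (endo_scale c * T) = T"
    using False by (intro endo_eqI) simp
  then have le: "op_bound p T \<le> cmod (inverse c) * op_bound p (endo_scale c * T)"
    using op_bound_scale_le[OF bdd_mult[OF bdd_endo_scale T], of "inverse c" c] by simp
  then have "cmod c * op_bound p T \<le> op_bound p (endo_scale c * T)"
    using mult_left_mono[OF le, of "cmod c"] False
    by (simp add: norm_inverse mult.assoc[symmetric])
  then show ?thesis
    using op_bound_scale_le[OF T, of c] by simp
qed

text \<open>The source is p (T a)^2 = p (a^* R T a), used for T and, with the roles exchanged, for
  R, which also makes the two norms equal.\<close>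

lemma op_bound_adjoint:
  assumes TR: "adjoint_pair T R" and b: "bdd p T" "bdd p R"
  shows "op_bound p (R * T) = (op_bound p T)\<^sup>2"
proof -
  have half: "op_bound p T \<le> sqrt (op_bound p (R * T))" if "adjoint_pair T R" "bdd p T" "bdd p R" for T R
  proof (rule op_bound_le)
    show "0 \<le> sqrt (op_bound p (R * T))"
      using that by (simp add: op_bound_nonneg bdd_mult)
    fix a
    have "(p (app T a))\<^sup>2 = p (star A a * app (R * T) a)"
      using that(1) p_star_mult[OF p, of "app T a"] by (simp add: adjoint_pair_def)
    also have "\<dots> \<le> p a * p (app (R * T) a)"
      using p_mult[OF p, of "star A a"] by (metis p_star[OF p])
    also have "\<dots> \<le> p a * (op_bound p (R * T) * p a)"
      using that by (intro mult_left_mono op_bound bdd_mult p_nonneg[OF p])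
    also have "\<dots> = (sqrt (op_bound p (R * T)) * p a)\<^sup>2"
      using that by (simp add: power_mult_distrib op_bound_nonneg bdd_mult power2_eq_square)
    finally show "p (app T a) \<le> sqrt (op_bound p (R * T)) * p a"
      by (rule power2_le_imp_le) (use that in \<open>simp add: op_bound_nonneg bdd_mult p_nonneg[OF p]\<close>)
  qed
  have le: "(op_bound p T)\<^sup>2 \<le> op_bound p (R * T)" if "adjoint_pair T R" "bdd p T" "bdd p R" for T R
    using power_mono[OF half[OF that] op_bound_nonneg[OF that(2)], of 2] that
    by (simp add: op_bound_nonneg bdd_mult)
  have norm_le: "op_bound p T \<le> op_bound p R" if "adjoint_pair T R" "bdd p T" "bdd p R" for T R
  proof (cases "op_bound p T = 0")
    case False
    have "op_bound p T * op_bound p T \<le> op_bound p R * op_bound p T"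
      using le[OF that] op_bound_mult[OF that(3,2)] by (simp add: power2_eq_square)
    then show ?thesis using False op_bound_nonneg[OF that(2)] by simp
  qed (use op_bound_nonneg[OF that(3)] in simp)
  have "op_bound p R = op_bound p T"
    using norm_le[OF TR b] norm_le[OF adjoint_pair_sym[OF TR] b(2,1)] by simp
  then show ?thesis
    using le[OF TR b] op_bound_mult[OF b(2,1)] by (simp add: power2_eq_square)
qed

lemma bdd_adjointables_iff:
  "T \<in> bdd_adjointables p \<longleftrightarrow> adjoint_pair T (endo_adj T) \<and> bdd p T \<and> bdd p (endo_adj T)"
  unfolding bdd_adjointables_def using endo_adj_eqI by auto

lemma bdd_adjointablesI: "adjoint_pair T R \<Longrightarrow> bdd p T \<Longrightarrow> bdd p R \<Longrightarrow> T \<in> bdd_adjointables p"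
  unfolding bdd_adjointables_def by auto

lemma unital_cstar_seminorm_bdd_adjointables:
  "unital_cstar_seminorm (bdd_adjointables p) endo_scale endo_adj (op_bound p)"
proof
  fix c d :: complex and T R
  show "endo_scale c \<in> bdd_adjointables p"
    by (rule bdd_adjointablesI[OF adjoint_pair_endo_scale bdd_endo_scale bdd_endo_scale])
  show "endo_adj (endo_scale c) = endo_scale (cnj c)"
    by (intro endo_adj_eqI adjoint_pair_endo_scale)
  show "endo_scale (c + d) = endo_scale c + endo_scale d"
    by (rule endo_eqI) (simp add: sc.scale_left_distrib)
  show "endo_scale (c * d) = endo_scale c * endo_scale d" "endo_scale 1 = 1"
    by (rule endo_eqI, simp)+
  assume T: "T \<in> bdd_adjointables p"
  note T' = T[unfolded bdd_adjointables_iff]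
  show adjT: "endo_adj T \<in> bdd_adjointables p"
    by (rule bdd_adjointablesI[of _ T]) (use T' adjoint_pair_sym in auto)
  show "endo_adj (endo_adj T) = T"
    using T' by (intro endo_adj_eqI adjoint_pair_sym[of T]) simp
  show "T * endo_scale c = endo_scale c * T"
    using T' by (auto intro!: endo_eqI simp: adjoint_pair_scale)
  show "op_bound p (endo_scale c * T) = cmod c * op_bound p T"
    using T' by (simp add: op_bound_scale)
  show "op_bound p (endo_adj T * T) = (op_bound p T)\<^sup>2"
    using T' by (simp add: op_bound_adjoint)
  assume R: "R \<in> bdd_adjointables p"
  note R' = R[unfolded bdd_adjointables_iff]
  show "T + R \<in> bdd_adjointables p" "T * R \<in> bdd_adjointables p"
    using T' R' by (meson bdd_adjointablesI adjoint_pair_add adjoint_pair_mult bdd_add bdd_mult)+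
  show "endo_adj (T + R) = endo_adj T + endo_adj R" "endo_adj (T * R) = endo_adj R * endo_adj T"
    using T' R' by (auto intro!: endo_adj_eqI adjoint_pair_add adjoint_pair_mult)
  show "op_bound p (T + R) \<le> op_bound p T + op_bound p R"
    "op_bound p (T * R) \<le> op_bound p T * op_bound p R"
    using T' R' by (auto intro: op_bound_add op_bound_mult)
qed

text \<open>Testing on \<open>star A x\<close> attains the bound, so passing to the unitization
  preserves \<open>p\<close>.\<close>

lemma op_bound_left_mult: "op_bound p (left_mult x) = p x"
proof (rule antisym)
  show "op_bound p (left_mult x) \<le> p x"
    using p_mult[OF p] p_nonneg[OF p] by (intro op_bound_le) auto
  have "p x * p x \<le> op_bound p (left_mult x) * p x"
    using op_bound[OF bdd_left_mult, of x "star A x"] p_star_mult[OF p, of "star A x"]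
    by (simp add: power2_eq_square p_star[OF p])
  then show "p x \<le> op_bound p (left_mult x)"
    using p_nonneg[OF p, of x] op_bound_nonneg[OF bdd_left_mult, of x]
    by (cases "p x = 0") auto
qed

text \<open>Left multiplication embeds the algebra isometrically into a unital one, where
  \<open>psd_star_mult\<close> and \<open>N_mono\<close> apply.\<close>

lemma pos_mono:
  assumes "x \<in> pos" "y \<in> pos" shows "p x \<le> p (x + y)"
proof -
  interpret U: unital_cstar_seminorm "bdd_adjointables p" endo_scale endo_adj "op_bound p"
    by (rule unital_cstar_seminorm_bdd_adjointables)
  have lm_in: "left_mult x \<in> bdd_adjointables p" for x
    by (rule bdd_adjointablesI[OF adjoint_pair_left_mult bdd_left_mult bdd_left_mult])
  have lm_add: "left_mult (x + y) = left_mult x + left_mult y" for x y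
    by (rule endo_eqI) (simp add: distrib_right)
  have psd: "U.psd (left_mult x)" if "x \<in> pos" for x
    using that
  proof induction
    case (star_mult_self x)
    have "left_mult (star A x * x) = endo_adj (left_mult x) * left_mult x"
      unfolding endo_adj_eqI[OF adjoint_pair_left_mult] by (rule endo_eqI) (simp add: mult.assoc)
    then show ?case using U.psd_star_mult[OF lm_in] by simp
  qed (simp add: lm_add U.psd_add)
  show ?thesis
    using U.N_mono[OF psd psd, OF assms] by (simp add: lm_add[symmetric] op_bound_left_mult)
qed

end

end

section \<open>Resolvents\<close>

context pro_cstar_algebra
begin

abbreviation rs :: "real \<Rightarrow> 'a \<Rightarrow> 'a" where
  "rs t x \<equiv> ascale A (complex_of_real t) x"

lemma star_rs: "star A (rs t x) = rs t (star A x)"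
  by (simp add: star_ascale)

lemma p_rs: "cstar_seminorm A p \<Longrightarrow> p (rs t x) = \<bar>t\<bar> * p x"
  by (simp add: p_scale)

lemma pos_0 [simp]: "0 \<in> pos"
  using pos.star_mult_self[of 0] by simp

lemma pos_rs: "x \<in> pos \<Longrightarrow> 0 \<le> t \<Longrightarrow> rs t x \<in> pos"
proof (induction rule: pos.induct)
  case (star_mult_self x)
  have "rs t (star A x * x) = star A (rs (sqrt t) x) * rs (sqrt t) x"
    using star_mult_self
    by (simp add: star_rs ascale_mult_left ascale_mult_right of_real_mult[symmetric] del: of_real_mult)
  then show ?case by (simp add: pos.star_mult_self)
next
  case (pos_add x y)
  then show ?case by (simp add: sc.scale_right_distrib pos.pos_add)
qed

lemma pos_le_p:
  assumes "p \<in> S" "x \<in> pos" "y \<in> pos" "x + y = z" shows "p x \<le> p z"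
  using pos_mono[OF S_cstar[OF assms(1)] assms(2,3)] assms(4) by simp

text \<open>The adjoint relation alone; additivity and both kinds of linearity follow by cancelling
  \<open>star A a\<close>.\<close>

definition self_adjoint :: "('a \<Rightarrow> 'a) \<Rightarrow> bool" where
  "self_adjoint B \<longleftrightarrow> (\<forall>a b. star A (B a) * b = star A a * B b)"

lemma self_adjointD: "self_adjoint B \<Longrightarrow> star A (B a) * b = star A a * B b"
  by (simp add: self_adjoint_def)

context
  fixes B assumes B: "self_adjoint B"
begin

lemma self_adjoint_rev: "star A a * B b = star A (B a) * b"
  using B by (simp add: self_adjoint_def)

lemma self_adjoint_add: "B (x + y) = B x + B y"
  by (rule star_mult_left_cancel) (simp add: self_adjoint_rev distrib_left)

lemma self_adjoint_ascale: "B (ascale A c x) = ascale A c (B x)"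
  by (rule star_mult_left_cancel) (simp add: self_adjoint_rev ascale_mult_right)

lemma self_adjoint_mult: "B (x * y) = B x * y"
  by (rule star_mult_left_cancel) (simp add: self_adjoint_rev mult.assoc[symmetric])

lemma self_adjoint_diff: "B (x - y) = B x - B y"
  using self_adjoint_add[of "x - y" y] by simp

end

text \<open>
  Richardson iteration for \<open>x + B x = a\<close> with step sizes tending to \<open>0\<close> non-summably; as no
  step size depends on the seminorm, it converges for all seminorms at once.
\<close>

lemma resolvent_solution:
  assumes B: "self_adjoint B" and pB: "\<And>a. star A a * B a \<in> pos"
    and bddB: "\<And>p. p \<in> S \<Longrightarrow> \<exists>C. \<forall>a. p (B a) \<le> C * p a"
  shows "\<exists>x. x + B x = a"
proof -
  \<comment> \<open>Then 1 - c k = k / (k + 4), whose products decay like k^-4. Squared seminorms of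
    the residuals eventually contract by this factor, so p (e k) is O(k^-2), which is
    summable.\<close>
  define c :: "nat \<Rightarrow> real" where "c k = 4 / (real k + 4)" for k
  have c: "0 \<le> c k" "c k \<le> 1" for k by (auto simp: c_def)
  define e where "e = rec_nat a (\<lambda>k z. z - rs (c k) (z + B z))"
  have e0: "e 0 = a" and eS: "e (Suc k) = e k - rs (c k) (e k + B (e k))" for k
    by (simp_all add: e_def)
  have step: "(p (e (Suc k)))\<^sup>2 \<le> ((1 - c k)\<^sup>2 + (c k)\<^sup>2 * C\<^sup>2) * (p (e k))\<^sup>2"
    if p: "p \<in> S" and C: "\<And>a. p (B a) \<le> C * p a" for p C k
  proof -
    note pc = S_cstar[OF p]
    define z where "z = e k"
    define t where "t = c k"
    have t: "0 \<le> t" "t \<le> 1" using c by (auto simp: t_def)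
    have f: "e (Suc k) = rs (1 - t) z - rs t (B z)"
      by (simp add: eS z_def[symmetric] t_def[symmetric] sc.scale_left_diff_distrib
          sc.scale_right_distrib)
    \<comment> \<open>The cross term of the square carries a negative sign; moved to the left it
      lies in \<open>pos\<close>, and \<open>pos_le_p\<close> discards it.\<close>
    have eq: "star A (e (Suc k)) * e (Suc k) + rs (2 * (t * (1 - t))) (star A z * B z)
        = rs ((1 - t)\<^sup>2) (star A z * z) + rs (t\<^sup>2) (star A (B z) * B z)"
    proof -
      define u where "u = complex_of_real (1 - t)"
      define w where "w = complex_of_real t"
      have u: "cnj u = u" "cnj w = w" by (simp_all add: u_def w_def)
      have sq: "complex_of_real ((1 - t)\<^sup>2) = u * u" "complex_of_real (t\<^sup>2) = w * w"
        "complex_of_real (2 * (t * (1 - t))) = u * w + w * u"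
        by (simp_all add: u_def w_def power2_eq_square)
      have two: "ascale A (v * 2) q = ascale A v q + ascale A v q" for v q
        by (simp only: mult_2_right sc.scale_left_distrib)
      show ?thesis
        unfolding f sq u_def[symmetric] w_def[symmetric]
        by (simp add: star_diff star_ascale u left_diff_distrib right_diff_distrib ascale_mult_left
            ascale_mult_right self_adjointD[OF B] sc.scale_left_distrib sc.scale_right_diff_distrib mult.commute two)
    qed
    have "p (star A (e (Suc k)) * e (Suc k))
        \<le> p (rs ((1 - t)\<^sup>2) (star A z * z) + rs (t\<^sup>2) (star A (B z) * B z))"
      by (rule pos_le_p[OF p pos.star_mult_self pos_rs[OF pB] eq]) (use t in simp)
    also have "\<dots> \<le> (1 - t)\<^sup>2 * (p z)\<^sup>2 + t\<^sup>2 * (p (B z))\<^sup>2"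
      using p_add[OF pc] by (metis abs_power2 p_rs[OF pc] p_star_mult[OF pc])
    also have "\<dots> \<le> (1 - t)\<^sup>2 * (p z)\<^sup>2 + t\<^sup>2 * (C * p z)\<^sup>2"
      using C p_nonneg[OF pc] by (intro add_left_mono mult_left_mono power_mono) auto
    finally show ?thesis
      by (simp add: p_star_mult[OF pc] z_def t_def algebra_simps power_mult_distrib)
  qed
  have sum_e: "summable (\<lambda>k. p (e k))" if p: "p \<in> S" for p
  proof -
    note pc = S_cstar[OF p]
    obtain C where C: "\<And>a. p (B a) \<le> C * p a" using bddB[OF p] by blast
    \<comment> \<open>From \<open>k0\<close> on, c k (1 + C^2) <= 1, which makes the contraction
      factor at most 1 - c k. The step sizes stay the same for all seminorms; only this index
      varies.\<close>
    define k0 where "k0 = Suc (nat \<lceil>4 * (1 + C\<^sup>2)\<rceil>)"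
    define G where "G k = (p (e k))\<^sup>2 * (real k * (real k + 1) * (real k + 2) * (real k + 3))" for k
    have G_Suc: "G (Suc k) \<le> G k" if k: "k \<ge> k0" for k
    proof -
      have "4 * (1 + C\<^sup>2) \<le> real k + 4"
        using k unfolding k0_def by linarith
      then have "c k * (1 + C\<^sup>2) \<le> 1"
        by (simp add: c_def field_simps)
      then have "c k * (c k * (1 + C\<^sup>2)) \<le> c k * 1"
        using c by (intro mult_left_mono) auto
      then have "(1 - c k)\<^sup>2 + (c k)\<^sup>2 * C\<^sup>2 \<le> 1 - c k"
        by (simp add: power2_eq_square algebra_simps)
      also have "\<dots> = real k / (real k + 4)"
        by (simp add: c_def field_simps)
      finally have "(p (e (Suc k)))\<^sup>2 \<le> real k / (real k + 4) * (p (e k))\<^sup>2"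
        using step[OF p C, of k] by (meson mult_right_mono order_trans zero_le_power2)
      then have "(p (e (Suc k)))\<^sup>2 * (real k + 4) \<le> real k * (p (e k))\<^sup>2"
        by (simp add: field_simps)
      then have "(p (e (Suc k)))\<^sup>2 * (real k + 4) * ((real k + 1) * (real k + 2) * (real k + 3))
          \<le> real k * (p (e k))\<^sup>2 * ((real k + 1) * (real k + 2) * (real k + 3))"
        by (intro mult_right_mono) auto
      then show ?thesis by (simp add: G_def mult_ac add_ac)
    qed
    have G_le: "G k \<le> G k0" if "k \<ge> k0" for k
      using that by (induction rule: dec_induct) (auto intro: order_trans[OF G_Suc])
    define D where "D = sqrt (G k0)"
    have "p (e k) \<le> D * inverse ((real k)\<^sup>2)" if k: "k \<ge> k0" for k
    proof -
      have k1: "real k \<ge> 1" using k by (simp add: k0_def)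
      have "(p (e k))\<^sup>2 * (real k * real k * real k * real k) \<le> G k"
        unfolding G_def by (intro mult_left_mono mult_mono) auto
      also have "\<dots> \<le> D\<^sup>2"
        using G_le[OF k] by (simp add: D_def G_def)
      finally have "(p (e k) * (real k)\<^sup>2)\<^sup>2 \<le> D\<^sup>2"
        by (simp add: power_mult_distrib power2_eq_square mult_ac)
      then have "p (e k) * (real k)\<^sup>2 \<le> D"
        by (rule power2_le_imp_le) (simp add: D_def G_def)
      then show ?thesis using k1 by (simp add: field_simps)
    qed
    then have le: "norm (p (e k)) \<le> D * inverse ((real k)\<^sup>2)" if "k \<ge> k0" for k
      using that p_nonneg[OF pc, of "e k"] by simp
    have "summable (\<lambda>k. D * inverse ((real k)\<^sup>2))"
      by (intro summable_mult inverse_power_summable) auto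
    then show ?thesis
      by (rule summable_comparison_test'[OF _ le])
  qed
  have "summable (\<lambda>k. p (rs (c k) (e k)))" if p: "p \<in> S" for p
  proof (rule summable_comparison_test'[OF sum_e[OF p]])
    fix k :: nat
    have "\<bar>c k\<bar> * p (e k) \<le> p (e k)"
      using c[of k] p_nonneg[OF S_cstar[OF p], of "e k"] by (intro mult_left_le_one_le) auto
    then show "norm (p (rs (c k) (e k))) \<le> p (e k)"
      using p_nonneg[OF S_cstar[OF p], of "e k"] by (simp add: p_rs[OF S_cstar[OF p]] abs_mult)
  qed
  then obtain x where x: "(\<lambda>n. \<Sum>k<n. rs (c k) (e k)) \<longlonglongrightarrow> x"
    by (rule convergent_if_summable_seminorms)
  define X where "X n = (\<Sum>k<n. rs (c k) (e k))" for n
  have X: "X n + B (X n) = a - e n" for n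
  proof (induction n)
    case 0
    have "B 0 = 0" using self_adjoint_add[OF B, of 0 0] by simp
    then show ?case by (simp add: X_def e0)
  next
    case (Suc n)
    have "X (Suc n) + B (X (Suc n)) = (X n + B (X n)) + rs (c n) (e n + B (e n))"
      by (simp add: X_def self_adjoint_add[OF B] self_adjoint_ascale[OF B] sc.scale_right_distrib)
    then show ?case by (simp add: Suc eS)
  qed
  have "x + B x - a = 0"
  proof (rule eq_0_if_seminorms)
    fix p assume p: "p \<in> S"
    note pc = S_cstar[OF p]
    obtain C where C: "\<And>a. p (B a) \<le> C * p a" using bddB[OF p] by blast
    have le: "p (x + B x - a) \<le> p (X n - x) + C * p (X n - x) + p (e n)" for n
    proof -
      have eq: "x + B x - a = - (X n - x) - B (X n - x) - e n"
        using X[of n] by (simp add: self_adjoint_diff[OF B] algebra_simps)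
      show ?thesis
        unfolding eq using p_diff[OF pc, of "- (X n - x) - B (X n - x)" "e n"]
          p_diff[OF pc, of "- (X n - x)" "B (X n - x)"] p_uminus[OF pc, of "X n - x"]
          C[of "X n - x"] by linarith
    qed
    have "(\<lambda>n. p (X n - x)) \<longlonglongrightarrow> 0"
      using seminorm_tendsto[OF x p] by (simp add: X_def)
    moreover have "(\<lambda>n. p (e n)) \<longlonglongrightarrow> 0"
      using sum_e[OF p] by (rule summable_LIMSEQ_zero)
    ultimately have "(\<lambda>n. p (X n - x) + C * p (X n - x) + p (e n)) \<longlonglongrightarrow> 0 + C * 0 + 0"
      by (intro tendsto_intros)
    then have "p (x + B x - a) \<le> 0 + C * 0 + 0"
      using le by (intro LIMSEQ_le_const) auto
    then show "p (x + B x - a) = 0"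
      using p_nonneg[OF pc, of "x + B x - a"] by simp
  qed
  then show ?thesis by (intro exI[of _ x]) simp
qed

text \<open>Solutions are chosen pointwise; expanding b as Y b + B (Y b) shows that the choice is
  self-adjoint, and thereby linear.\<close>

lemma resolvent_exists:
  assumes B: "self_adjoint B" and pB: "\<And>a. star A a * B a \<in> pos"
    and bddB: "\<And>p. p \<in> S \<Longrightarrow> \<exists>C. \<forall>a. p (B a) \<le> C * p a"
  obtains Y where "self_adjoint Y" "\<And>a. Y a + B (Y a) = a"
proof -
  obtain Y where Y: "\<And>a. Y a + B (Y a) = a"
    using resolvent_solution[OF assms] by metis
  have "star A (Y a) * b = star A a * Y b" for a b
  proof -
    have "star A (Y a) * (Y b + B (Y b)) = star A (Y a + B (Y a)) * Y b"
      using self_adjointD[OF B, of "Y a" "Y b"] by (simp add: distrib_left distrib_right star_add)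
    then show ?thesis by (simp add: Y)
  qed
  then show ?thesis using that Y by (auto simp: self_adjoint_def)
qed

text \<open>With y = Y a, the square of a = y + B y expands into terms that all lie in
  \<open>pos\<close>.\<close>

lemma resolvent_bounds:
  assumes B: "self_adjoint B" and pB: "\<And>a. star A a * B a \<in> pos" and Y: "\<And>a. Y a + B (Y a) = a"
    and p: "p \<in> S"
  shows "p (Y a) \<le> p a" "p (B (Y a)) \<le> p a"
proof -
  note pc = S_cstar[OF p]
  define y where "y = Y a"
  have a: "a = y + B y" by (simp add: y_def Y)
  have eq: "star A a * a = star A y * y + (star A y * B y + star A y * B y) + star A (B y) * B y"
    unfolding a using self_adjointD[OF B, of y y]
    by (simp add: star_add distrib_left distrib_right add_ac)
  have "p (star A y * y) \<le> p (star A a * a)"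
    by (rule pos_le_p[OF p, of _ "(star A y * B y + star A y * B y) + star A (B y) * B y"])
       (auto simp: eq add.assoc intro!: pos.intros pB)
  then have "(p y)\<^sup>2 \<le> (p a)\<^sup>2" by (simp add: p_star_mult[OF pc])
  then show "p (Y a) \<le> p a"
    unfolding y_def by (rule power2_le_imp_le) (rule p_nonneg[OF pc])
  have "p (star A (B y) * B y) \<le> p (star A a * a)"
    by (rule pos_le_p[OF p, of _ "star A y * y + (star A y * B y + star A y * B y)"])
       (auto simp: eq add_ac intro!: pos.intros pB)
  then have "(p (B y))\<^sup>2 \<le> (p a)\<^sup>2" by (simp add: p_star_mult[OF pc])
  then show "p (B (Y a)) \<le> p a"
    unfolding y_def by (rule power2_le_imp_le) (rule p_nonneg[OF pc])
qed

lemma pre_hilbert_self: "pre_hilbert_module A (self_module A)"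
proof (intro pre_hilbert_module.intro pre_hilbert_module_axioms.intro)
  fix x :: 'a
  show "alg_le A 0 (ip (self_module A) x x)"
    by (auto simp: self_module_def alg_le_def)
qed (unfold_locales; simp add: self_module_def sc.scale_left_distrib sc.scale_right_distrib distrib_left
    distrib_right mult.assoc ascale_mult_left ascale_mult_right star_mult star_mult_self_eq_0
    pro_cstar_algebra_axioms ascale_vector_space)+

end

section \<open>Hilbert modules and multipliers\<close>

context pre_hilbert_module
begin

sublocale ms: vector_space "mscale E"
  by (rule mscale_vector_space)

lemma ip_0_right [simp]: "ip E \<xi> 0 = 0"
  using ip_add[of \<xi> 0 0] by simp

lemma ip_diff_right: "ip E \<xi> (\<eta> - \<zeta>) = ip E \<xi> \<eta> - ip E \<xi> \<zeta>"
  using ip_add[of \<xi> "\<eta> - \<zeta>" \<zeta>] by simp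

lemma ip_add_left: "ip E (\<xi> + \<eta>) \<zeta> = ip E \<xi> \<zeta> + ip E \<eta> \<zeta>"
  by (metis ip_add ip_star star_add)

lemma ip_diff_left: "ip E (\<xi> - \<eta>) \<zeta> = ip E \<xi> \<zeta> - ip E \<eta> \<zeta>"
  using ip_add_left[of "\<xi> - \<eta>" \<eta> \<zeta>] by simp

lemma ip_0_left [simp]: "ip E 0 \<xi> = 0"
  using ip_add_left[of 0 0 \<xi>] by simp

lemma ip_mscale_left: "ip E (mscale E c \<xi>) \<eta> = ascale A (cnj c) (ip E \<xi> \<eta>)"
  by (metis ip_mscale ip_star star_ascale)

lemma ip_act_left: "ip E (act E \<xi> a) \<eta> = star A a * ip E \<xi> \<eta>"
  by (metis ip_act ip_star star_mult)

lemma ip_right_cancel: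
  assumes "\<And>\<zeta>. ip E \<zeta> \<xi> = ip E \<zeta> \<eta>" shows "\<xi> = \<eta>"
proof -
  have "ip E (\<xi> - \<eta>) (\<xi> - \<eta>) = 0"
    using assms[of "\<xi> - \<eta>"] by (simp add: ip_diff_right)
  then show ?thesis by (simp add: ip_eq_0_iff)
qed

lemma ip_pos: "ip E \<xi> \<xi> \<in> pos"
proof -
  obtain b where "ip E \<xi> \<xi> - 0 = star A b * b"
    using ip_nonneg unfolding alg_le_def by blast
  then show ?thesis by (simp add: pos.star_mult_self)
qed

lemma mod_seminorm_nonneg [simp]: "p \<in> S \<Longrightarrow> 0 \<le> mod_seminorm E p \<xi>"
  by (simp add: mod_seminorm_def p_nonneg[OF S_cstar])

lemma mod_seminorm_sq: "p \<in> S \<Longrightarrow> (mod_seminorm E p \<xi>)\<^sup>2 = p (ip E \<xi> \<xi>)"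
  by (simp add: mod_seminorm_def p_nonneg[OF S_cstar])

lemma mod_seminorm_0 [simp]: "p \<in> S \<Longrightarrow> mod_seminorm E p 0 = 0"
  by (simp add: mod_seminorm_def p_0[OF S_cstar])

text \<open>With w the inner product, positivity of the square of \<xi> s w - \<eta> and
  monotonicity of p give a quadratic inequality in the real parameter s.\<close>

lemma Cauchy_Schwarz:
  assumes p: "p \<in> S"
  shows "p (ip E \<xi> \<eta>) \<le> mod_seminorm E p \<xi> * mod_seminorm E p \<eta>"
proof -
  note pc = S_cstar[OF p]
  define w where "w = ip E \<xi> \<eta>"
  define W X Y where "W = (p w)\<^sup>2" and "X = p (ip E \<xi> \<xi>)" and "Y = p (ip E \<eta> \<eta>)"
  have nonneg: "0 \<le> W" "0 \<le> X" "0 \<le> Y"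
    by (simp_all add: W_def X_def Y_def p_nonneg[OF pc])
  have key: "2 * s * W \<le> s\<^sup>2 * W * X + Y" if s: "s \<ge> 0" for s
  proof -
    define u where "u = complex_of_real s"
    have u: "cnj u = u" by (simp add: u_def)
    have sq: "complex_of_real (s\<^sup>2) = u * u" "complex_of_real (2 * s) = u * 2"
      by (simp_all add: u_def power2_eq_square)
    define z where "z = act E \<xi> (ascale A u w) - \<eta>"
    have two: "ascale A (v * 2) q = ascale A v q + ascale A v q" for v q
      by (simp only: mult_2_right sc.scale_left_distrib)
    have w': "ip E \<eta> \<xi> = star A w" by (simp add: w_def ip_star)
    have eq: "rs (2 * s) (star A w * w) + ip E z z = rs (s\<^sup>2) (star A w * ip E \<xi> \<xi> * w) + ip E \<eta> \<eta>"
      unfolding sq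
      by (simp add: z_def ip_diff_left ip_diff_right ip_act ip_act_left w' w_def[symmetric] star_ascale u
          ascale_mult_left ascale_mult_right mult.assoc sc.scale_right_diff_distrib two
          left_diff_distrib)
    have "2 * s * W = p (rs (2 * s) (star A w * w))"
      using s by (simp only: p_rs[OF pc] p_star_mult[OF pc] W_def)
    also have "\<dots> \<le> p (rs (s\<^sup>2) (star A w * ip E \<xi> \<xi> * w) + ip E \<eta> \<eta>)"
      by (rule pos_le_p[OF p pos_rs[OF pos.star_mult_self] ip_pos eq]) (use s in simp)
    also have "\<dots> \<le> s\<^sup>2 * p (star A w * ip E \<xi> \<xi> * w) + Y"
      unfolding Y_def by (metis abs_power2 p_add[OF pc] p_rs[OF pc])
    also have "p (star A w * ip E \<xi> \<xi> * w) \<le> p (star A w) * X * p w"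
      unfolding X_def
      by (intro order_trans[OF p_mult[OF pc]] mult_right_mono p_mult[OF pc] p_nonneg[OF pc])
    also have "\<dots> = W * X"
      by (simp add: W_def p_star[OF pc] power2_eq_square)
    finally show ?thesis by (simp add: mult_left_mono mult.assoc)
  qed
  have "W \<le> X * Y"
  proof (cases "X = 0")
    case True
    have "W = 0"
    proof (rule ccontr)
      assume "W \<noteq> 0"
      \<comment> \<open>For X = 0 the quadratic term is gone, and a large s refutes W > 0.\<close>
      then have "2 * ((Y + 1) / W) * W \<le> Y"
        using key[of "(Y + 1) / W"] True nonneg by simp
      then show False using \<open>W \<noteq> 0\<close> nonneg by simp
    qed
    then show ?thesis using True by simp
  next
    case False
    then have X: "X > 0" using nonneg by simp
    have "2 * (1 / X) * W \<le> (1 / X)\<^sup>2 * W * X + Y"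
      using X by (intro key) simp
    then show ?thesis using X by (simp add: field_simps power2_eq_square)
  qed
  then have "(p w)\<^sup>2 \<le> (mod_seminorm E p \<xi> * mod_seminorm E p \<eta>)\<^sup>2"
    by (simp add: power_mult_distrib mod_seminorm_sq[OF p] W_def X_def Y_def)
  then show ?thesis
    unfolding w_def by (rule power2_le_imp_le) (simp add: p)
qed

lemma mod_seminorm_triangle:
  assumes p: "p \<in> S"
  shows "mod_seminorm E p (\<xi> + \<eta>) \<le> mod_seminorm E p \<xi> + mod_seminorm E p \<eta>"
proof (rule power2_le_imp_le)
  note pc = S_cstar[OF p]
  have "(mod_seminorm E p (\<xi> + \<eta>))\<^sup>2 = p ((ip E \<xi> \<xi> + ip E \<xi> \<eta>) + (ip E \<eta> \<xi> + ip E \<eta> \<eta>))"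
    by (simp add: mod_seminorm_sq[OF p] ip_add ip_add_left add_ac)
  also have "\<dots> \<le> (p (ip E \<xi> \<xi>) + p (ip E \<xi> \<eta>)) + (p (ip E \<eta> \<xi>) + p (ip E \<eta> \<eta>))"
    by (intro order_trans[OF p_add[OF pc]] add_mono p_add[OF pc])
  also have "\<dots> \<le> (mod_seminorm E p \<xi> + mod_seminorm E p \<eta>)\<^sup>2"
    using Cauchy_Schwarz[OF p, of \<xi> \<eta>] Cauchy_Schwarz[OF p, of \<eta> \<xi>]
    by (simp add: mod_seminorm_sq[OF p, symmetric] power2_sum mult.commute)
  finally show "(mod_seminorm E p (\<xi> + \<eta>))\<^sup>2 \<le> (mod_seminorm E p \<xi> + mod_seminorm E p \<eta>)\<^sup>2" .
qed (simp add: p)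

lemma mod_seminorm_mscale: "p \<in> S \<Longrightarrow> mod_seminorm E p (mscale E c \<xi>) = cmod c * mod_seminorm E p \<xi>"
  by (simp add: mod_seminorm_def ip_mscale ip_mscale_left p_scale[OF S_cstar] real_sqrt_mult
      mult.assoc[symmetric] norm_mult)

text \<open>Keeps the adjoint as explicit data in place of \<open>adj\<close>, and only the adjoint
  relation; linearity of both maps follows by cancellation.\<close>

definition multiplier_pair :: "('a \<Rightarrow> 'e) \<Rightarrow> ('e \<Rightarrow> 'a) \<Rightarrow> bool" where
  "multiplier_pair h g \<longleftrightarrow> (\<forall>a \<xi>. ip E (h a) \<xi> = star A a * g \<xi>)"

context
  fixes h g assumes hg: "multiplier_pair h g"
begin

lemma multiplier_pair_left: "ip E (h a) \<xi> = star A a * g \<xi>"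
  using hg by (simp add: multiplier_pair_def)

lemma multiplier_pair_right: "ip E \<xi> (h a) = star A (g \<xi>) * a"
  by (metis multiplier_pair_left ip_star star_mult star_star)

lemma multiplier_add: "h (a + b) = h a + h b"
  by (rule ip_right_cancel) (simp add: multiplier_pair_right ip_add distrib_left)

lemma multiplier_mult: "h (a * b) = act E (h a) b"
  by (rule ip_right_cancel) (simp add: multiplier_pair_right ip_act mult.assoc)

lemma multiplier_ascale: "h (ascale A c a) = mscale E c (h a)"
  by (rule ip_right_cancel) (simp add: multiplier_pair_right ip_mscale ascale_mult_right)

lemma multiplier_adj_add: "g (\<xi> + \<eta>) = g \<xi> + g \<eta>"
  by (rule star_mult_left_cancel) (simp add: multiplier_pair_left[symmetric] ip_add distrib_left)

lemma multiplier_adj_diff: "g (\<xi> - \<eta>) = g \<xi> - g \<eta>"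
  by (rule star_mult_left_cancel)
     (simp add: multiplier_pair_left[symmetric] ip_diff_right right_diff_distrib)

lemma multiplier_adj_act: "g (act E \<xi> a) = g \<xi> * a"
  by (rule star_mult_left_cancel)
     (simp add: multiplier_pair_left[symmetric] ip_act mult.assoc[symmetric])

lemma multiplier_adj_mscale: "g (mscale E c \<xi>) = ascale A c (g \<xi>)"
  by (rule star_mult_left_cancel)
     (simp add: multiplier_pair_left[symmetric] ip_mscale ascale_mult_right)

lemma is_adjoint_if_multiplier_pair: "is_adjoint (self_module A) E h g"
  unfolding is_adjoint_def module_morphism_def Vector_Spaces.linear_def
    module_hom_def module_hom_axioms_def
  by (auto simp: self_module_def multiplier_adj_add multiplier_adj_act multiplier_adj_mscale
      multiplier_pair_left module_iff_vector_space ascale_vector_space mscale_vector_space)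

lemma multiplier_module_if_multiplier_pair: "h \<in> multiplier_module A E"
  unfolding multiplier_module_def adjointables_def
  using is_adjoint_if_multiplier_pair
  by (auto simp: module_morphism_def Vector_Spaces.linear_def
      module_hom_def module_hom_axioms_def self_module_def multiplier_add multiplier_mult
      multiplier_ascale module_iff_vector_space ascale_vector_space mscale_vector_space)

lemma mult_ip_left_eq: "mult_ip_left A E h \<xi> = g \<xi>"
  using pre_hilbert_module.adj_eqI[OF pre_hilbert_self is_adjoint_if_multiplier_pair]
  by (simp add: mult_ip_left_def)

lemma self_adjoint_multiplier: "self_adjoint (\<lambda>a. g (h a))"
  by (simp add: self_adjoint_def multiplier_pair_left[symmetric] multiplier_pair_right[symmetric])

lemma pos_multiplier: "star A a * g (h a) \<in> pos"
  by (simp add: multiplier_pair_left[symmetric] ip_pos)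

text \<open>
  With \<open>B = h\<^sup>* h\<close> and \<open>Y = (1 + B)\<^sup>-\<^sup>1\<close>, the multiplier \<open>h Y\<close> is a contraction: the
  vectors \<open>\<zeta> - h w\<close> and \<open>h w\<close>, with \<open>w = Y h\<^sup>* \<zeta>\<close>, have inner product \<open>w\<^sup>* w\<close>.
\<close>

lemma ip_minus_truncation_pos:
  assumes Y: "\<And>a. Y a + g (h (Y a)) = a"
  shows "ip E \<zeta> \<zeta> - star A (Y (g \<zeta>)) * Y (g \<zeta>) \<in> pos"
proof -
  define w where "w = Y (g \<zeta>)"
  define z where "z = \<zeta> - h w"
  have \<zeta>: "\<zeta> = z + h w" by (simp add: z_def)
  have gz: "g z = w"
    using Y[of "g \<zeta>"] by (simp add: z_def multiplier_adj_diff w_def algebra_simps)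
  have "ip E \<zeta> \<zeta> = ip E z z + star A w * w + star A w * w + ip E (h w) (h w)"
    by (subst (1 2) \<zeta>) (simp add: ip_add ip_add_left multiplier_pair_left[of w z]
        multiplier_pair_right[of z w] gz)
  then have "ip E \<zeta> \<zeta> - star A w * w = ip E z z + star A w * w + ip E (h w) (h w)"
    by simp
  then show ?thesis
    unfolding w_def[symmetric] by (auto intro!: pos.intros ip_pos)
qed

end

lemma multiplier_pair_exists:
  assumes "h \<in> multiplier_module A E" obtains g where "multiplier_pair h g"
  using assms
  by (auto simp: multiplier_module_def adjointables_def is_adjoint_def multiplier_pair_def self_module_def)

lemma multiplier_pair_embed: "multiplier_pair (multiplier_embed E \<xi>) (\<lambda>\<eta>. ip E \<xi> \<eta>)"
  by (simp add: multiplier_pair_def multiplier_embed_def ip_act_left)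

lemma multiplier_pair_zero: "multiplier_pair (\<lambda>a. 0) (\<lambda>\<eta>. 0)"
  by (simp add: multiplier_pair_def)

lemma multiplier_pair_add:
  "multiplier_pair h g \<Longrightarrow> multiplier_pair h' g' \<Longrightarrow>
    multiplier_pair (\<lambda>a. h a + h' a) (\<lambda>\<eta>. g \<eta> + g' \<eta>)"
  by (simp add: multiplier_pair_def ip_add_left distrib_left)

lemma multiplier_pair_mscale:
  "multiplier_pair h g \<Longrightarrow> multiplier_pair (\<lambda>a. mscale E c (h a)) (\<lambda>\<eta>. ascale A (cnj c) (g \<eta>))"
  by (simp add: multiplier_pair_def ip_mscale_left ascale_mult_right)

end

section \<open>Boundedness of multipliers and truncation\<close>

context pro_cstar_algebra
begin

text \<open>The element is \<open>c (1 + c\<^sup>* c)\<^sup>-\<^sup>1\<close>.\<close>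

lemma bounded_truncation:
  assumes p: "p \<in> S" and c: "p c = 1"
  shows "\<exists>a. (\<forall>q\<in>S. q a \<le> 1) \<and> 1/2 \<le> p (star A a * c)"
proof -
  interpret M: pre_hilbert_module A "self_module A"
    by (rule pre_hilbert_self)
  have mp: "M.multiplier_pair (\<lambda>a. c * a) (\<lambda>a. star A c * a)"
    unfolding M.multiplier_pair_def by (simp add: self_module_def star_mult mult.assoc)
  define B where "B a = star A c * (c * a)" for a
  have B: "self_adjoint B" and pB: "\<And>a. star A a * B a \<in> pos"
    using M.self_adjoint_multiplier[OF mp] M.pos_multiplier[OF mp] by (simp_all add: B_def[abs_def])
  have "\<exists>C. \<forall>a. q (B a) \<le> C * q a" if "q \<in> S" for q
    using p_mult[OF S_cstar[OF that], of "star A c * c"]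
    by (auto simp: B_def mult.assoc[symmetric])
  then obtain Y where Y: "self_adjoint Y" "\<And>a. Y a + B (Y a) = a"
    using resolvent_exists[OF B pB] by metis
  define w where "w = Y (star A c)"
  have w_mult: "w * x = Y (star A c * x)" for x
    by (simp add: w_def self_adjoint_mult[OF Y(1)])
  have q_w: "q w \<le> 1" if q: "q \<in> S" for q
  proof -
    note qc = S_cstar[OF q]
    \<comment> \<open>Contractivity tested on the vector w^* bounds the square of w w^* by w w^*
      itself, so (q w)^4 <= (q w)^2 for every q.\<close>
    have "star A (star A w) * star A w - star A (w * star A w) * (w * star A w) \<in> pos"
      using M.ip_minus_truncation_pos[OF mp, of Y "star A w"] Y(2)
      by (simp add: w_mult self_module_def B_def)
    then have "q (star A (w * star A w) * (w * star A w)) \<le> q (star A (star A w) * star A w)"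
      by (rule pos_le_p[OF q pos.star_mult_self]) simp
    then have "(q (star A (star A w) * star A w))\<^sup>2 \<le> q (star A (star A w) * star A w)"
      by (subst (asm) p_star_mult[OF qc]) simp
    then have "((q w)\<^sup>2)\<^sup>2 \<le> (q w)\<^sup>2"
      by (simp only: p_star_mult[OF qc] p_star[OF qc])
    then have "(q w)\<^sup>2 * (q w)\<^sup>2 \<le> 1 * (q w)\<^sup>2"
      by (simp add: power2_eq_square)
    then have "q w = 0 \<or> (q w)\<^sup>2 \<le> 1\<^sup>2"
      by (metis mult_right_le_imp_le one_power2 zero_less_power2)
    then show ?thesis
      using power2_le_imp_le[of "q w" 1] by auto
  qed
  note pc = S_cstar[OF p]
  define b where "b = star A c * c"
  have pb: "p b = 1" using p_star_mult[OF pc, of c] c by (simp add: b_def)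
  \<comment> \<open>As p b = 1, this equation gives 1 <= 2 p (Y b), and Y b = w c; hence the
    1/2.\<close>
  have "Y b + b * Y b = b"
    using Y(2)[of b] by (simp add: B_def b_def mult.assoc)
  then have "p b \<le> p (Y b) + p (b * Y b)"
    using p_add[OF pc] by metis
  also have "\<dots> \<le> p (Y b) + 1 * p (Y b)"
    using p_mult[OF pc, of b "Y b"] pb by simp
  finally have "1/2 \<le> p (star A (star A w) * c)"
    using pb by (simp add: w_mult b_def)
  then show ?thesis
    using q_w by (intro exI[of _ "star A w"]) (simp add: p_star[OF S_cstar])
qed

text \<open>
  The signs are chosen as in Sokal's proof of the uniform boundedness principle: of \<open>x + u\<close> and
  \<open>x - u\<close>, one pairs with \<open>c\<close> at least as strongly as \<open>u\<close> does.
\<close>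

lemma gliding_sum:
  assumes p: "p \<in> S" and c: "\<And>n. p (c n) = 1"
  obtains z where "\<And>n. (1/8) ^ n / 5 \<le> p (star A z * c n)"
proof -
  note pc = S_cstar[OF p]
  have "\<forall>n. \<exists>a. (\<forall>q\<in>S. q a \<le> 1) \<and> 1/2 \<le> p (star A a * c n)"
    using bounded_truncation[OF p c] by blast
  then obtain a where a: "\<And>n q. q \<in> S \<Longrightarrow> q (a n) \<le> 1" "\<And>n. 1/2 \<le> p (star A (a n) * c n)"
    by (auto dest!: choice)
  \<comment> \<open>With ratio 1/8, the tail after n sums to (1/8)^n / 7, and 1/2 - 1/7 > 1/5. The
    series converges in every seminorm because the truncations are bounded by 1 in all of
    them.\<close>
  define v where "v n = rs ((1/8) ^ n) (a n)" for n :: nat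
  have q_v: "q (v n) \<le> (1/8) ^ n" if "q \<in> S" for q n
    unfolding v_def p_rs[OF S_cstar[OF that]] using a(1)[OF that, of n] by (simp add: mult_left_le)
  have v: "(1/8) ^ n / 2 \<le> p (star A (v n) * c n)" for n
    unfolding v_def star_rs ascale_mult_left p_rs[OF pc]
    using mult_left_mono[OF a(2)[of n], of "(1/8) ^ n"] by simp
  have sign: "\<exists>u. (u = v n \<or> u = - v n) \<and> (1/8) ^ n / 2 \<le> p (star A (x + u) * c n)" for x n
  proof (rule ccontr)
    assume "\<not> ?thesis"
    then have lt: "p (star A (x + v n) * c n) < (1/8) ^ n / 2" "p (star A (x - v n) * c n) < (1/8) ^ n / 2"
      by (auto simp: not_le)
    have eq: "rs 2 (star A (v n) * c n) = star A (x + v n) * c n - star A (x - v n) * c n"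
      using sc.scale_left_distrib[of 1 1 "star A (v n) * c n"]
      by (simp add: star_add star_diff distrib_right left_diff_distrib)
    have "2 * p (star A (v n) * c n) = p (rs 2 (star A (v n) * c n))"
      by (simp only: p_rs[OF pc] abs_numeral)
    also have "\<dots> \<le> p (star A (x + v n) * c n) + p (star A (x - v n) * c n)"
      unfolding eq by (rule p_diff[OF pc])
    finally show False using lt v[of n] by simp
  qed
  define u where "u x n = (SOME u. (u = v n \<or> u = - v n) \<and> (1/8) ^ n / 2 \<le> p (star A (x + u) * c n))" for x n
  have u: "u x n = v n \<or> u x n = - v n" "(1/8) ^ n / 2 \<le> p (star A (x + u x n) * c n)" for x n
    using someI_ex[OF sign[of n x]] unfolding u_def by blast+
  define x where "x = rec_nat 0 (\<lambda>n y. y + u y n)"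
  have x: "x 0 = 0" "x (Suc n) = x n + u (x n) n" for n
    by (simp_all add: x_def)
  define d where "d n = u (x n) n" for n
  have x_sum: "x n = (\<Sum>i<n. d i)" for n
    by (induction n) (simp_all add: x d_def)
  have q_d: "q (d n) \<le> (1/8) ^ n" if "q \<in> S" for q n
    using u(1)[of "x n" n] q_v[OF that, of n] p_uminus[OF S_cstar[OF that], of "v n"]
    by (auto simp: d_def)
  have "summable (\<lambda>n. q (d n))" if q: "q \<in> S" for q
    by (rule summable_comparison_test'[where g = "\<lambda>n. (1/8) ^ n"])
       (use q_d[OF q] p_nonneg[OF S_cstar[OF q]] in auto)
  then obtain z where z: "(\<lambda>n. \<Sum>i<n. d i) \<longlonglongrightarrow> z"
    by (rule convergent_if_summable_seminorms)
  have tail: "p (x (Suc n + k) - x (Suc n)) \<le> (1/8) ^ n / 7" for n k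
  proof -
    have "p (x (Suc n + k) - x (Suc n)) \<le> (1/8) ^ n / 7 - (1/8) ^ (n + k) / 7"
    proof (induction k)
      case (Suc k)
      have eq: "x (Suc n + Suc k) - x (Suc n) = (x (Suc n + k) - x (Suc n)) + d (Suc n + k)"
        by (simp add: x_sum)
      have "p (x (Suc n + Suc k) - x (Suc n)) \<le> p (x (Suc n + k) - x (Suc n)) + p (d (Suc n + k))"
        unfolding eq by (rule p_add[OF pc])
      then show ?case using Suc q_d[OF p, of "Suc n + k"] by (simp add: power_add)
    qed (simp add: p_0[OF pc])
    then show ?thesis by (smt (verit) divide_nonneg_nonneg zero_le_power)
  qed
  have tail': "p (z - x (Suc n)) \<le> (1/8) ^ n / 7" for n
  proof -
    have "(\<lambda>m. p (x m - z)) \<longlonglongrightarrow> 0"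
      using seminorm_tendsto[OF z p] by (simp add: x_sum)
    then have "(\<lambda>k. p (x (k + Suc n) - z) + (1/8) ^ n / 7) \<longlonglongrightarrow> 0 + (1/8) ^ n / 7"
      by (intro tendsto_add tendsto_const) (rule LIMSEQ_ignore_initial_segment)
    moreover have "p (z - x (Suc n)) \<le> p (x (k + Suc n) - z) + (1/8) ^ n / 7" for k
      using p_add[OF pc, of "z - x (k + Suc n)" "x (k + Suc n) - x (Suc n)"] tail[of n k]
        p_minus_commute[OF pc, of z "x (k + Suc n)"] by (simp add: add.commute)
    ultimately show ?thesis
      by (intro LIMSEQ_le_const[where a = "p (z - x (Suc n))"]) auto
  qed
  show ?thesis
  proof (rule that[of z])
    fix n
    have "p (star A (z - x (Suc n)) * c n) \<le> (1/8) ^ n / 7"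
      using p_mult[OF pc, of "star A (z - x (Suc n))" "c n"] tail'[of n]
      by (simp add: c p_star[OF pc])
    moreover have "(1/8) ^ n / 2 \<le> p (star A (x (Suc n)) * c n)"
      using u(2)[of n "x n"] by (simp add: x)
    moreover have eq: "star A (x (Suc n)) * c n = star A z * c n - star A (z - x (Suc n)) * c n"
      by (simp add: star_diff left_diff_distrib)
    have "p (star A (x (Suc n)) * c n) \<le> p (star A z * c n) + p (star A (z - x (Suc n)) * c n)"
      unfolding eq by (rule p_diff[OF pc])
    moreover have "0 < (1/8::real) ^ n" by simp
    ultimately show "(1/8) ^ n / 5 \<le> p (star A z * c n)" by linarith
  qed
qed

end

context pre_hilbert_module
begin

text \<open>Uniform boundedness by a gliding hump: were \<open>g\<close> unbounded for p, a single z
  would pair so strongly with the normalised \<open>g (\<eta> n)\<close> that Cauchy-Schwarz puts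
  the seminorm of \<open>h z\<close> above every integer.\<close>

lemma multiplier_adj_bounded:
  assumes hg: "multiplier_pair h g" and p: "p \<in> S"
  shows "\<exists>C\<ge>0. \<forall>\<eta>. p (g \<eta>) \<le> C * mod_seminorm E p \<eta>"
proof (rule ccontr)
  note pc = S_cstar[OF p]
  assume "\<not> ?thesis"
  then have "\<exists>\<eta>. C * mod_seminorm E p \<eta> < p (g \<eta>)" if "0 \<le> C" for C
    using that by (meson not_le)
  \<comment> \<open>The factor 5 and the power of 8 cancel the loss in \<open>gliding_sum\<close>;
    what remains is the unbounded n + 1.\<close>
  then have "\<exists>\<eta>. (5 * 8 ^ n * real (Suc n)) * mod_seminorm E p \<eta> < p (g \<eta>)" for n :: nat
    by simp
  then obtain \<eta> where \<eta>: "\<And>n. 5 * 8 ^ n * real (Suc n) * mod_seminorm E p (\<eta> n) < p (g (\<eta> n))"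
    by metis
  define M where "M n = p (g (\<eta> n))" for n
  have M: "0 < M n" for n
  proof -
    have "0 \<le> 5 * 8 ^ n * real (Suc n) * mod_seminorm E p (\<eta> n)"
      using p by simp
    then show ?thesis using \<eta>[of n] by (simp only: M_def)
  qed
  define c where "c n = rs (1 / M n) (g (\<eta> n))" for n
  have "p (c n) = 1" for n
    unfolding c_def p_rs[OF pc] using M[of n] by (simp add: M_def[symmetric])
  then obtain z where z: "\<And>n. (1/8) ^ n / 5 \<le> p (star A z * c n)"
    using gliding_sum[OF p] by metis
  have le: "real (Suc n) \<le> mod_seminorm E p (h z)" for n
  proof (rule ccontr)
    assume "\<not> ?thesis"
    then have lt: "mod_seminorm E p (h z) < real (Suc n)" by simp
    have "M n * ((1/8) ^ n / 5) \<le> M n * p (star A z * c n)"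
      using z M by (intro mult_left_mono) (auto intro: less_imp_le)
    also have "\<dots> = p (ip E (h z) (\<eta> n))"
      unfolding c_def ascale_mult_right p_rs[OF pc]
      using M[of n] by (simp add: multiplier_pair_left[OF hg])
    also have "\<dots> \<le> mod_seminorm E p (h z) * mod_seminorm E p (\<eta> n)"
      by (rule Cauchy_Schwarz[OF p])
    also have "\<dots> \<le> real (Suc n) * mod_seminorm E p (\<eta> n)"
      using lt p by (intro mult_right_mono) auto
    finally have "M n \<le> 5 * 8 ^ n * real (Suc n) * mod_seminorm E p (\<eta> n)"
      by (simp add: field_simps)
    then show False using \<eta>[of n] unfolding M_def by linarith
  qed
  obtain n where "mod_seminorm E p (h z) < real n"
    using reals_Archimedean2 by blast
  then show False using le[of n] by simp
qed

lemma multiplier_bounded: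
  assumes hg: "multiplier_pair h g" and p: "p \<in> S"
  shows "\<exists>C\<ge>0. \<forall>a. mod_seminorm E p (h a) \<le> C * p a"
proof -
  note pc = S_cstar[OF p]
  obtain C where C: "0 \<le> C" "\<And>\<eta>. p (g \<eta>) \<le> C * mod_seminorm E p \<eta>"
    using multiplier_adj_bounded[OF hg p] by blast
  have "mod_seminorm E p (h a) \<le> C * p a" for a
  proof (cases "mod_seminorm E p (h a) = 0")
    case False
    have "mod_seminorm E p (h a) * mod_seminorm E p (h a) = p (star A a * g (h a))"
      using mod_seminorm_sq[OF p, of "h a"]
      by (simp add: multiplier_pair_left[OF hg] power2_eq_square)
    also have "\<dots> \<le> p (star A a) * p (g (h a))"
      by (rule p_mult[OF pc])
    also have "\<dots> \<le> p a * (C * mod_seminorm E p (h a))"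
      using C(2)[of "h a"] p_nonneg[OF pc] by (simp add: p_star[OF pc] mult_left_mono)
    finally have "mod_seminorm E p (h a) * mod_seminorm E p (h a) \<le> (C * p a) * mod_seminorm E p (h a)"
      by (simp add: mult_ac)
    then show ?thesis using False mod_seminorm_nonneg[OF p, of "h a"] by simp
  qed (use C p_nonneg[OF pc] in simp)
  then show ?thesis using C by blast
qed

lemma multiplier_resolvent:
  assumes hg: "multiplier_pair h g"
  obtains Y where "self_adjoint Y" "\<And>a. Y a + g (h (Y a)) = a"
proof -
  have "\<exists>C. \<forall>a. p (g (h a)) \<le> C * p a" if p: "p \<in> S" for p
  proof -
    obtain C where C: "0 \<le> C" "\<And>\<eta>. p (g \<eta>) \<le> C * mod_seminorm E p \<eta>"
      using multiplier_adj_bounded[OF hg p] by blast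
    obtain D where D: "\<And>a. mod_seminorm E p (h a) \<le> D * p a"
      using multiplier_bounded[OF hg p] by blast
    have "p (g (h a)) \<le> C * (D * p a)" for a
      using C D by (meson mult_left_mono order_trans)
    then show ?thesis by (auto simp: mult.assoc intro: exI[of _ "C * D"])
  qed
  then show ?thesis
    using resolvent_exists[OF self_adjoint_multiplier[OF hg] pos_multiplier[OF hg]] that by metis
qed

text \<open>The approximant is a = b (1 + b)^-1 with b = n <\<xi>, \<xi>>. For \<zeta> = sqrt n
  \<xi>, the square of \<zeta> - \<zeta> a is a - a^* a, of seminorm at most 2 whatever n
  is.\<close>

lemma approximate_unit:
  assumes p: "p \<in> S" and e: "e > 0"
  obtains a where "mod_seminorm E p (\<xi> - act E \<xi> a) < e"
proof -
  note pc = S_cstar[OF p]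
  obtain n :: nat where n: "2 / e\<^sup>2 < real n"
    using reals_Archimedean2 by blast
  have n0: "0 < real n" using n e by (meson divide_pos_pos less_trans zero_less_numeral zero_less_power)
  define t where "t = sqrt (real n)"
  have t: "0 < t" "t\<^sup>2 = real n" using n0 by (simp_all add: t_def)
  define \<zeta> where "\<zeta> = mscale E (complex_of_real t) \<xi>"
  define b where "b = ip E \<zeta> \<zeta>"
  have mp: "multiplier_pair (multiplier_embed E \<zeta>) (\<lambda>\<eta>. ip E \<zeta> \<eta>)"
    by (rule multiplier_pair_embed)
  obtain Y where Y: "self_adjoint Y" "\<And>a. Y a + b * Y a = a"
    by (rule multiplier_resolvent[OF mp]) (auto simp: multiplier_embed_def ip_act b_def)
  define a where "a = Y b"
  have B: "self_adjoint (\<lambda>a. b * a)" and pB: "\<And>a. star A a * (b * a) \<in> pos"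
    using self_adjoint_multiplier[OF mp] pos_multiplier[OF mp]
    by (simp_all add: multiplier_embed_def ip_act b_def)
  have ba: "b - b * a = a"
    using Y(2)[of b] by (simp add: a_def algebra_simps)
  have stb: "star A b = b" by (simp add: b_def ip_star)
  \<comment> \<open>Y commutes with b: both sides solve x + b x = b d, and self-adjointness makes Y
    a left inverse of 1 + b too. The right-hand form is the one that \<open>resolvent_bounds\<close>
    controls, giving p a <= 1.\<close>
  have a_mult: "a * d = b * Y d" for d
  proof -
    define x where "x = a * d - b * Y d"
    have "a * d + b * (a * d) = b * d"
      using Y(2)[of "b * d"] by (simp add: a_def self_adjoint_mult[OF Y(1)])
    moreover have "b * Y d + b * (b * Y d) = b * d"
      using arg_cong[OF Y(2)[of d], of "\<lambda>x. b * x"] by (simp add: distrib_left)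
    ultimately have "x + b * x = 0"
      by (simp add: x_def right_diff_distrib algebra_simps)
    moreover have "x = Y (x + b * x)"
    proof -
      have "star A c * x = star A c * Y (x + b * x)" for c
      proof -
        have "star A c * Y (x + b * x) = star A (Y c) * (x + b * x)"
          by (simp add: self_adjointD[OF Y(1)])
        also have "\<dots> = star A (Y c + b * Y c) * x"
          by (simp add: distrib_left distrib_right star_add star_mult stb mult.assoc)
        finally show ?thesis by (simp add: Y(2))
      qed
      then show ?thesis by (rule star_mult_left_cancel)
    qed
    ultimately have "x = Y 0" by simp
    also have "Y 0 = 0" using self_adjoint_diff[OF Y(1), of 0 0] by simp
    finally show ?thesis by (simp add: x_def)
  qed
  have "(p a)\<^sup>2 = p (a * star A a)"
    using p_star_mult[OF pc, of "star A a"] by (simp add: p_star[OF pc])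
  also have "\<dots> \<le> p (star A a)"
    unfolding a_mult by (rule resolvent_bounds(2)[OF B pB Y(2) p])
  finally have "p a * p a \<le> 1 * p a" by (simp add: p_star[OF pc] power2_eq_square)
  then have pa: "p a \<le> 1"
    using p_nonneg[OF pc, of a] by (cases "p a = 0") auto
  have "ip E (\<zeta> - act E \<zeta> a) (\<zeta> - act E \<zeta> a) = (b - b * a) - star A a * (b - b * a)"
    by (simp add: ip_diff_left ip_diff_right ip_act ip_act_left b_def[symmetric] right_diff_distrib
        left_diff_distrib mult.assoc)
  also have "\<dots> = a - star A a * a" by (simp only: ba)
  also have "p \<dots> \<le> p a + p (star A a * a)" by (rule p_diff[OF pc])
  also have "\<dots> \<le> 2"
    using pa p_nonneg[OF pc, of a] power_le_one[of "p a" 2] by (simp add: p_star_mult[OF pc])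
  finally have "(mod_seminorm E p (\<zeta> - act E \<zeta> a))\<^sup>2 \<le> 2"
    by (simp add: mod_seminorm_sq[OF p])
  moreover have "\<zeta> - act E \<zeta> a = mscale E (complex_of_real t) (\<xi> - act E \<xi> a)"
    by (simp add: \<zeta>_def act_mscale ms.scale_right_diff_distrib)
  ultimately have "real n * (mod_seminorm E p (\<xi> - act E \<xi> a))\<^sup>2 \<le> 2"
    by (simp add: mod_seminorm_mscale[OF p] power_mult_distrib t(2))
  moreover have "2 < real n * e\<^sup>2"
    using n e by (simp add: pos_divide_less_eq)
  ultimately have "real n * (mod_seminorm E p (\<xi> - act E \<xi> a))\<^sup>2 < real n * e\<^sup>2"
    by simp
  then have "mod_seminorm E p (\<xi> - act E \<xi> a) < e"
    using n0 e by (simp add: power2_less_imp_less)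
  then show ?thesis by (rule that)
qed

end

section \<open>The iteration\<close>

lemma (in pro_cstar_algebra) pos_sum:
  "finite J \<Longrightarrow> (\<And>j. j \<in> J \<Longrightarrow> f j \<in> pos) \<Longrightarrow> sum f J \<in> pos"
  by (induction J rule: finite_induct) (auto intro: pos.pos_add)

lemma (in pro_cstar_algebra) sum_const_rs: "finite J \<Longrightarrow> (\<Sum>j\<in>J. x) = rs (real (card J)) x"
  by (induction J rule: finite_induct) (auto simp: sc.scale_left_distrib)

lemma eventually_le_card_Int_lessThan:
  fixes J :: "nat set"
  assumes "infinite J"
  shows "eventually (\<lambda>N. m \<le> card {j\<in>J. j < N}) sequentially"
proof -
  obtain F where F: "F \<subseteq> J" "finite F" "card F = m"
    using infinite_arbitrarily_large[OF assms, of m] by blast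
  obtain b where b: "\<And>j. j \<in> F \<Longrightarrow> j < b"
    using F(2) unfolding finite_nat_set_iff_bounded by blast
  show ?thesis
    unfolding eventually_sequentially
  proof (intro exI[of _ b] allI impI)
    fix N assume "b \<le> N"
    then have "F \<subseteq> {j\<in>J. j < N}" using F(1) b by force
    then show "m \<le> card {j\<in>J. j < N}"
      using F(3) card_mono[of "{j\<in>J. j < N}" F] by simp
  qed
qed

context pre_hilbert_module
begin

definition symmetric_op :: "('e \<Rightarrow> 'e) \<Rightarrow> bool" where
  "symmetric_op R \<longleftrightarrow> (\<forall>\<xi> \<eta>. ip E (R \<xi>) \<eta> = ip E \<xi> (R \<eta>))"

lemma symmetric_opD: "symmetric_op R \<Longrightarrow> ip E (R \<xi>) \<eta> = ip E \<xi> (R \<eta>)"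
  by (simp add: symmetric_op_def)

lemma symmetric_op_add: "symmetric_op R \<Longrightarrow> R (\<xi> + \<eta>) = R \<xi> + R \<eta>"
  by (rule ip_right_cancel) (simp add: symmetric_opD[symmetric] ip_add)

lemma symmetric_op_diff: "symmetric_op R \<Longrightarrow> R (\<xi> - \<eta>) = R \<xi> - R \<eta>"
  by (rule ip_right_cancel) (simp add: symmetric_opD[symmetric] ip_diff_right)

lemma symmetric_op_mscale: "symmetric_op R \<Longrightarrow> R (mscale E c \<xi>) = mscale E c (R \<xi>)"
  by (rule ip_right_cancel) (simp add: symmetric_opD[symmetric] ip_mscale)

end

locale contraction_sequence = pre_hilbert_module A E
  for A :: "'a::{ring, uniform_space, t2_space} star_alg" and E :: "('a, 'e::ab_group_add) ip_module" +
  fixes h :: "nat \<Rightarrow> 'a \<Rightarrow> 'e" and g :: "nat \<Rightarrow> 'e \<Rightarrow> 'a"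
  assumes hg: "multiplier_pair (h j) (g j)"
    and contraction: "ip E \<zeta> \<zeta> - star A (g j \<zeta>) * g j \<zeta> \<in> pos"
begin

primrec R :: "nat \<Rightarrow> 'e \<Rightarrow> 'e" where
  "R 0 \<xi> = \<xi>"
| "R (Suc j) \<xi> = R j \<xi> - R j (h j (g j (R j \<xi>)))"

lemma symmetric_R: "symmetric_op (R j)"
proof (induction j)
  case (Suc j)
  have "ip E (R (Suc j) \<xi>) \<eta> = ip E (R j \<xi>) \<eta> - star A (g j (R j \<xi>)) * g j (R j \<eta>)" for \<xi> \<eta>
    using symmetric_opD[OF Suc, of "h j (g j (R j \<xi>))" \<eta>]
    by (simp add: ip_diff_left multiplier_pair_left[OF hg])
  moreover have "ip E \<xi> (R (Suc j) \<eta>) = ip E (R j \<xi>) \<eta> - star A (g j (R j \<xi>)) * g j (R j \<eta>)" for \<xi> \<eta>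
    using symmetric_opD[OF Suc, of \<xi> "h j (g j (R j \<eta>))"] symmetric_opD[OF Suc, of \<xi> \<eta>]
    by (simp add: ip_diff_right multiplier_pair_right[OF hg])
  ultimately show ?case
    unfolding symmetric_op_def by simp
qed (simp add: symmetric_op_def)

lemma R_sym: "ip E (R j \<xi>) \<eta> = ip E \<xi> (R j \<eta>)"
  by (rule symmetric_opD[OF symmetric_R])

lemma R_diff: "R j (\<xi> - \<eta>) = R j \<xi> - R j \<eta>"
  by (rule symmetric_op_diff[OF symmetric_R])

text \<open>By \<open>R - R\<^sup>2 = R (1 - R) R + (1 - R) R (1 - R)\<close>, no square root of \<open>R\<close> is needed.\<close>

lemma ip_R_minus_square_pos_aux:
  assumes "\<And>\<xi>. ip E \<xi> (R j \<xi>) \<in> pos" "\<And>\<xi>. ip E \<xi> \<xi> - ip E \<xi> (R j \<xi>) \<in> pos"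
  shows "ip E \<xi> (R j \<xi>) - ip E (R j \<xi>) (R j \<xi>) \<in> pos"
proof -
  define \<eta> where "\<eta> = R j \<xi>"
  have "ip E \<xi> (R j \<eta>) = ip E \<eta> \<eta>" "ip E \<eta> (R j \<xi>) = ip E \<eta> \<eta>"
    by (simp_all add: R_sym[symmetric] \<eta>_def)
  then have "ip E \<xi> \<eta> - ip E \<eta> \<eta>
      = (ip E \<eta> \<eta> - ip E \<eta> (R j \<eta>)) + ip E (\<xi> - \<eta>) (R j (\<xi> - \<eta>))"
    by (simp add: R_diff ip_diff_left ip_diff_right \<eta>_def[symmetric])
  then show ?thesis
    unfolding \<eta>_def[symmetric] using pos.pos_add[OF assms(2)[of \<eta>] assms(1)[of "\<xi> - \<eta>"]] by simp
qed

lemma ip_R_Suc: "ip E \<xi> (R (Suc j) \<xi>) = ip E \<xi> (R j \<xi>) - star A (g j (R j \<xi>)) * g j (R j \<xi>)"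
  by (simp add: ip_diff_right R_sym[symmetric] multiplier_pair_right[OF hg])

text \<open>The induction is joint, as positivity of R - R^2 uses both bounds on R. With P = h g, R
  - R P R = (R - R^2) + R (1 - P) R, and 1 - P >= 0 is where contractivity enters.\<close>

lemma R_pos: "ip E \<xi> (R j \<xi>) \<in> pos" and R_le_1: "ip E \<xi> \<xi> - ip E \<xi> (R j \<xi>) \<in> pos"
proof (induction j arbitrary: \<xi>)
  case 0
  { case 1 show ?case by (simp add: ip_pos) }
  { case 2 show ?case by simp }
next
  case (Suc j)
  { case 1
    have eq: "ip E \<xi> (R (Suc j) \<xi>) = (ip E \<xi> (R j \<xi>) - ip E (R j \<xi>) (R j \<xi>))
        + (ip E (R j \<xi>) (R j \<xi>) - star A (g j (R j \<xi>)) * g j (R j \<xi>))"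
      unfolding ip_R_Suc by simp
    show ?case
      unfolding eq by (intro pos.pos_add ip_R_minus_square_pos_aux[OF Suc] contraction) }
  { case 2
    have eq: "ip E \<xi> \<xi> - ip E \<xi> (R (Suc j) \<xi>)
        = (ip E \<xi> \<xi> - ip E \<xi> (R j \<xi>)) + star A (g j (R j \<xi>)) * g j (R j \<xi>)"
      unfolding ip_R_Suc by simp
    show ?case
      unfolding eq by (intro pos.pos_add Suc(2) pos.star_mult_self) }
qed

lemma ip_R_minus_square_pos: "ip E \<xi> (R j \<xi>) - ip E (R j \<xi>) (R j \<xi>) \<in> pos"
  by (rule ip_R_minus_square_pos_aux[OF R_pos R_le_1])

text \<open>
  This says \<open>R S R \<le> R\<close> for \<open>S = 1 + \<Sum>i<j. h\<^sub>i h\<^sub>i\<^sup>*\<close>, a substitute for \<open>R \<le> S\<^sup>-\<^sup>1\<close>.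
\<close>

lemma R_sum_le:
  "ip E \<xi> (R j \<xi>) - ip E (R j \<xi>) (R j \<xi>) - (\<Sum>i<j. star A (g i (R j \<xi>)) * g i (R j \<xi>)) \<in> pos"
proof (induction j arbitrary: \<xi>)
  case (Suc j)
  define \<zeta> where "\<zeta> = R j \<xi>"
  define y where "y = h j (g j \<zeta>)"
  \<comment> \<open>The induction hypothesis is used at x instead of \<xi>, because R (Suc j) \<xi>
    = R j x. Besides the new summand, what is left over is exactly <y, R (Suc j) y>.\<close>
  define x where "x = \<xi> - y"
  define \<eta> where "\<eta> = R (Suc j) \<xi>"
  have \<eta>: "\<eta> = R j x" "\<eta> = \<zeta> - R j y"
    by (simp_all add: \<eta>_def x_def R_diff y_def \<zeta>_def)
  have g\<eta>: "g j \<eta> = g j \<zeta> - g j (R j y)"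
    unfolding \<eta>(2) by (rule multiplier_adj_diff[OF hg])
  have yRy: "ip E y (R (Suc j) y) = star A (g j (R j y)) * g j \<eta>"
  proof -
    have "ip E y (R j y) = star A (g j (R j y)) * g j \<zeta>"
      by (simp add: R_sym[symmetric] y_def multiplier_pair_right[OF hg])
    then show ?thesis
      unfolding ip_R_Suc g\<eta> by (simp add: right_diff_distrib)
  qed
  have "ip E \<xi> \<eta> = ip E x \<eta> + star A (g j \<zeta>) * g j \<eta>"
    by (simp add: x_def ip_diff_left y_def multiplier_pair_left[OF hg])
  moreover have "star A (g j \<zeta>) * g j \<eta> = star A (g j \<eta>) * g j \<eta> + ip E y (R (Suc j) y)"
    unfolding yRy distrib_right[symmetric] star_add[symmetric] by (simp add: g\<eta>)
  ultimately have eq: "ip E \<xi> \<eta> - ip E \<eta> \<eta> - (\<Sum>i<Suc j. star A (g i \<eta>) * g i \<eta>)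
      = (ip E x (R j x) - ip E (R j x) (R j x) - (\<Sum>i<j. star A (g i (R j x)) * g i (R j x)))
        + ip E y (R (Suc j) y)"
    by (simp add: \<eta>(1))
  show ?case
    unfolding \<eta>_def[symmetric] eq by (intro pos.pos_add Suc R_pos)
qed simp

lemma p_ip_R_square_le:
  assumes p: "p \<in> S"
  shows "(mod_seminorm E p (R j \<xi>))\<^sup>2 \<le> p (ip E \<xi> (R j \<xi>))"
  unfolding mod_seminorm_sq[OF p]
  by (rule pos_le_p[OF p ip_pos ip_R_minus_square_pos[of \<xi> j]]) simp

lemma p_ip_R_le: "p \<in> S \<Longrightarrow> p (ip E \<xi> (R j \<xi>)) \<le> p (ip E \<xi> \<xi>)"
  by (rule pos_le_p[OF _ R_pos R_le_1[of \<xi> j]]) simp_all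

lemma mod_seminorm_R_le:
  assumes p: "p \<in> S"
  shows "mod_seminorm E p (R j \<xi>) \<le> mod_seminorm E p \<xi>"
proof (rule power2_le_imp_le)
  show "(mod_seminorm E p (R j \<xi>))\<^sup>2 \<le> (mod_seminorm E p \<xi>)\<^sup>2"
    using p_ip_R_square_le[OF p, of j \<xi>] p_ip_R_le[OF p, of \<xi> j]
    by (simp add: mod_seminorm_sq[OF p])
qed (simp add: p)

text \<open>In \<open>R_sum_le\<close> all indices of J below j contribute the same square, and the
  other summands are positive.\<close>

lemma card_p_adj_R_le:
  assumes p: "p \<in> S" and g': "\<And>i. i \<in> J \<Longrightarrow> g i = g'"
  shows "real (card {i\<in>J. i < j}) * (p (g' (R j \<xi>)))\<^sup>2 \<le> p (ip E \<xi> \<xi>)"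
proof -
  note pc = S_cstar[OF p]
  let ?J = "{i\<in>J. i < j}" and ?f = "\<lambda>i. star A (g i (R j \<xi>)) * g i (R j \<xi>)"
  have split: "sum ?f {..<j} = sum ?f ?J + sum ?f ({..<j} - ?J)"
    by (subst add.commute, rule sum.subset_diff) auto
  have J: "sum ?f ?J = rs (real (card ?J)) (star A (g' (R j \<xi>)) * g' (R j \<xi>))"
    using g' by (subst sum_const_rs[symmetric]) (auto intro!: sum.cong)
  have "p (sum ?f ?J) \<le> p (ip E \<xi> (R j \<xi>))"
  proof (rule pos_le_p[OF p])
    show "sum ?f ?J \<in> pos" by (intro pos_sum pos.star_mult_self) auto
    show "sum ?f ({..<j} - ?J) + (ip E (R j \<xi>) (R j \<xi>)
        + (ip E \<xi> (R j \<xi>) - ip E (R j \<xi>) (R j \<xi>) - sum ?f {..<j})) \<in> pos"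
      by (intro pos.pos_add pos_sum pos.star_mult_self ip_pos R_sum_le) auto
    show "sum ?f ?J + (sum ?f ({..<j} - ?J) + (ip E (R j \<xi>) (R j \<xi>)
        + (ip E \<xi> (R j \<xi>) - ip E (R j \<xi>) (R j \<xi>) - sum ?f {..<j}))) = ip E \<xi> (R j \<xi>)"
      unfolding split by simp
  qed
  then have "real (card ?J) * (p (g' (R j \<xi>)))\<^sup>2 \<le> p (ip E \<xi> (R j \<xi>))"
    unfolding J p_rs[OF pc] p_star_mult[OF pc] by simp
  then show ?thesis using p_ip_R_le[OF p, of \<xi> j] by simp
qed

section \<open>Vectors on which the iteration tends to 0\<close>

definition vanishing :: "'e set" where
  "vanishing = {\<xi>. \<forall>p\<in>S. (\<lambda>j. mod_seminorm E p (R j \<xi>)) \<longlonglongrightarrow> 0}"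

text \<open>For \<xi> = h' a, the squared seminorm of R j \<xi> is at most p a times p (g' (R j
  \<xi>)), and \<open>card_p_adj_R_le\<close> sends the latter to 0 as j passes more and more
  indices of J.\<close>

lemma vanishing_repeated:
  assumes J: "infinite J" "\<And>j. j \<in> J \<Longrightarrow> g j = g'" and h': "multiplier_pair h' g'"
  shows "h' a \<in> vanishing"
proof -
  define \<xi> where "\<xi> = h' a"
  have "(\<lambda>j. mod_seminorm E p (R j \<xi>)) \<longlonglongrightarrow> 0" if p: "p \<in> S" for p
  proof -
    note pc = S_cstar[OF p]
    define M where "M = p a * mod_seminorm E p \<xi>"
    have M: "0 \<le> M" using p by (simp add: M_def p_nonneg[OF pc])
    have le: "(mod_seminorm E p (R j \<xi>))\<^sup>2 \<le> p a * p (g' (R j \<xi>))" for j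
    proof -
      have "(mod_seminorm E p (R j \<xi>))\<^sup>2 \<le> p (ip E (h' a) (R j \<xi>))"
        using p_ip_R_square_le[OF p, of j \<xi>] by (simp add: \<xi>_def)
      also have "\<dots> \<le> p (star A a) * p (g' (R j \<xi>))"
        unfolding multiplier_pair_left[OF h'] by (rule p_mult[OF pc])
      finally show ?thesis by (simp add: p_star[OF pc])
    qed
    show ?thesis
    proof (rule LIMSEQ_I)
      fix e :: real assume e: "e > 0"
      \<comment> \<open>The square of the quantity to be kept below e^2 will be bounded by M^2 /
        m.\<close>
      obtain m :: nat where m: "(M / e\<^sup>2)\<^sup>2 < real m"
        using reals_Archimedean2 by blast
      obtain n0 where n0: "\<And>j. j \<ge> n0 \<Longrightarrow> m \<le> card {i\<in>J. i < j}"
        using eventually_le_card_Int_lessThan[OF J(1), of m] by (auto simp: eventually_sequentially)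
      show "\<exists>no. \<forall>n\<ge>no. norm (mod_seminorm E p (R n \<xi>) - 0) < e"
      proof (intro exI[of _ n0] allI impI)
        fix j assume j: "n0 \<le> j"
        have m0: "0 < real m" using m by (meson le_less_trans zero_le_power2)
        have "real m * (p (g' (R j \<xi>)))\<^sup>2 \<le> real (card {i\<in>J. i < j}) * (p (g' (R j \<xi>)))\<^sup>2"
          using n0[OF j] by (intro mult_right_mono) auto
        also have "\<dots> \<le> (mod_seminorm E p \<xi>)\<^sup>2"
          unfolding mod_seminorm_sq[OF p] by (rule card_p_adj_R_le[OF p J(2)])
        finally have *: "real m * (p (g' (R j \<xi>)))\<^sup>2 \<le> (mod_seminorm E p \<xi>)\<^sup>2" .
        have "real m * (p a * p (g' (R j \<xi>)))\<^sup>2 \<le> M\<^sup>2"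
          using mult_left_mono[OF *, of "(p a)\<^sup>2"] by (simp add: M_def power_mult_distrib mult_ac)
        also have "\<dots> < real m * (e\<^sup>2)\<^sup>2"
          using m e by (simp add: power_divide divide_less_eq)
        finally have "(p a * p (g' (R j \<xi>)))\<^sup>2 < (e\<^sup>2)\<^sup>2"
          using m0 by simp
        then have "p a * p (g' (R j \<xi>)) < e\<^sup>2"
          by (rule power2_less_imp_less) simp
        then have "(mod_seminorm E p (R j \<xi>))\<^sup>2 < e\<^sup>2"
          using le[of j] by linarith
        then have "mod_seminorm E p (R j \<xi>) < e"
          by (rule power2_less_imp_less) (use e in simp)
        then show "norm (mod_seminorm E p (R j \<xi>) - 0) < e"
          using p by simp
      qed
    qed
  qed
  then show ?thesis by (simp add: vanishing_def \<xi>_def)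
qed

lemma vanishing_0: "0 \<in> vanishing"
  using symmetric_op_diff[OF symmetric_R, of _ 0 0] by (simp add: vanishing_def)

lemma vanishing_add:
  assumes "\<xi> \<in> vanishing" "\<eta> \<in> vanishing" shows "\<xi> + \<eta> \<in> vanishing"
  unfolding vanishing_def
proof (intro CollectI ballI)
  fix p assume p: "p \<in> S"
  have lim: "(\<lambda>j. mod_seminorm E p (R j \<xi>) + mod_seminorm E p (R j \<eta>)) \<longlonglongrightarrow> 0 + 0"
    using assms p by (intro tendsto_add) (auto simp: vanishing_def)
  show "(\<lambda>j. mod_seminorm E p (R j (\<xi> + \<eta>))) \<longlonglongrightarrow> 0"
    by (rule real_tendsto_sandwich[OF _ _ tendsto_const lim[simplified]])
       (auto simp: p symmetric_op_add[OF symmetric_R] mod_seminorm_triangle)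
qed

lemma vanishing_mscale:
  assumes "\<xi> \<in> vanishing" shows "mscale E c \<xi> \<in> vanishing"
  unfolding vanishing_def
proof (intro CollectI ballI)
  fix p assume p: "p \<in> S"
  have "(\<lambda>j. cmod c * mod_seminorm E p (R j \<xi>)) \<longlonglongrightarrow> cmod c * 0"
    using assms p by (intro tendsto_mult tendsto_const) (auto simp: vanishing_def)
  then show "(\<lambda>j. mod_seminorm E p (R j (mscale E c \<xi>))) \<longlonglongrightarrow> 0"
    by (simp add: symmetric_op_mscale[OF symmetric_R] mod_seminorm_mscale[OF p])
qed

text \<open>All R j are contractions in every seminorm, so the approximation error stays small
  uniformly in j.\<close>

lemma vanishing_closed:
  assumes "\<And>p e. p \<in> S \<Longrightarrow> e > 0 \<Longrightarrow> \<exists>\<eta>\<in>vanishing. mod_seminorm E p (\<xi> - \<eta>) < e"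
  shows "\<xi> \<in> vanishing"
  unfolding vanishing_def
proof (intro CollectI ballI LIMSEQ_I)
  fix p and e :: real assume p: "p \<in> S" and e: "0 < e"
  obtain \<eta> where \<eta>: "\<eta> \<in> vanishing" "mod_seminorm E p (\<xi> - \<eta>) < e / 2"
    using assms[OF p, of "e / 2"] e by auto
  have "(\<lambda>j. mod_seminorm E p (R j \<eta>)) \<longlonglongrightarrow> 0"
    using \<eta>(1) p by (auto simp: vanishing_def)
  then have "eventually (\<lambda>j. mod_seminorm E p (R j \<eta>) < e / 2) sequentially"
    by (rule order_tendstoD) (use e in simp)
  then obtain n0 where n0: "\<And>j. j \<ge> n0 \<Longrightarrow> mod_seminorm E p (R j \<eta>) < e / 2"
    unfolding eventually_sequentially by blast
  show "\<exists>no. \<forall>n\<ge>no. norm (mod_seminorm E p (R n \<xi>) - 0) < e"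
  proof (intro exI[of _ n0] allI impI)
    fix j assume "n0 \<le> j"
    then have "mod_seminorm E p (R j \<eta>) < e / 2" by (rule n0)
    moreover have "mod_seminorm E p (R j \<xi>) \<le> mod_seminorm E p (R j \<eta>) + mod_seminorm E p (R j (\<xi> - \<eta>))"
      using mod_seminorm_triangle[OF p, of "R j \<eta>" "R j (\<xi> - \<eta>)"] by (simp add: R_diff)
    moreover have "mod_seminorm E p (R j (\<xi> - \<eta>)) < e / 2"
      using mod_seminorm_R_le[OF p, of j "\<xi> - \<eta>"] \<eta>(2) by simp
    ultimately show "norm (mod_seminorm E p (R j \<xi>) - 0) < e"
      using p by simp
  qed
qed

text \<open>By \<open>ip_R_Suc\<close> the partial sums telescope to <\<xi>, \<xi>> - <\<xi>, R n
  \<xi>>, and Cauchy-Schwarz sends the last term to 0.\<close>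

lemma normalised_frame_if_vanishing:
  assumes "vanishing = UNIV"
  shows "standard_normalised_frame_of_multipliers A E (\<lambda>j a. R j (h j a))"
proof -
  have mp: "multiplier_pair (\<lambda>a. R j (h j a)) (\<lambda>\<xi>. g j (R j \<xi>))" for j
    unfolding multiplier_pair_def by (simp add: R_sym multiplier_pair_left[OF hg])
  let ?t = "\<lambda>\<xi> j. mult_ip_right A E \<xi> (\<lambda>a. R j (h j a)) * mult_ip_left A E (\<lambda>a. R j (h j a)) \<xi>"
  have t: "?t \<xi> j = star A (g j (R j \<xi>)) * g j (R j \<xi>)" for \<xi> j
    by (simp add: mult_ip_right_def mult_ip_left_eq[OF mp])
  have partial: "(\<Sum>j<n. ?t \<xi> j) - ip E \<xi> \<xi> = - ip E \<xi> (R n \<xi>)" for \<xi> n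
  proof (induction n)
    case (Suc n)
    then show ?case using ip_R_Suc[of \<xi> n] by (simp only: sum.lessThan_Suc t) (simp add: algebra_simps)
  qed simp
  have sums: "?t \<xi> sums ip E \<xi> \<xi>" for \<xi>
    unfolding sums_def
  proof (rule tendsto_if_seminorms)
    fix p assume p: "p \<in> S"
    note pc = S_cstar[OF p]
    have "(\<lambda>n. mod_seminorm E p (R n \<xi>)) \<longlonglongrightarrow> 0"
      using assms p by (auto simp: vanishing_def)
    then have "(\<lambda>n. mod_seminorm E p \<xi> * mod_seminorm E p (R n \<xi>)) \<longlonglongrightarrow> mod_seminorm E p \<xi> * 0"
      by (intro tendsto_mult tendsto_const)
    then have lim: "(\<lambda>n. mod_seminorm E p \<xi> * mod_seminorm E p (R n \<xi>)) \<longlonglongrightarrow> 0"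
      by simp
    show "(\<lambda>n. p ((\<Sum>j<n. ?t \<xi> j) - ip E \<xi> \<xi>)) \<longlonglongrightarrow> 0"
      unfolding partial p_uminus[OF pc]
      by (rule real_tendsto_sandwich[OF _ _ tendsto_const lim])
         (auto simp: p_nonneg[OF pc] Cauchy_Schwarz[OF p])
  qed
  \<comment> \<open>The series sums to <\<xi>, \<xi>>, so both frame inequalities are equalities,
    with witness b = 0.\<close>
  have refl: "alg_le A x x" for x
    unfolding alg_le_def by (intro exI[of _ 0]) simp
  show ?thesis
    unfolding standard_normalised_frame_of_multipliers_def frame_with_bounds_def
    using multiplier_module_if_multiplier_pair[OF mp] sums_summable[OF sums] sums_unique[OF sums]
    by (simp add: refl)
qed

end

section \<open>Closed submodules of the multiplier module\<close>

context pre_hilbert_module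
begin

lemma op_seminorm_bound:
  assumes p: "p \<in> S" and D: "\<And>t a. D (rs t a) = mscale E (complex_of_real t) (D a)"
    and lt: "op_seminorm (self_module A) E p D < ereal d"
  shows "mod_seminorm E p (D a) < d * (p a + 1)"
proof -
  note pc = S_cstar[OF p]
  \<comment> \<open>Adding 1 avoids a division by p a = 0.\<close>
  define t where "t = p a + 1"
  have t: "0 < t" using p_nonneg[OF pc, of a] by (simp add: t_def)
  define b where "b = rs (1 / t) a"
  have pb: "p b \<le> 1"
    unfolding b_def p_rs[OF pc] using t p_nonneg[OF pc, of a] by (simp add: t_def field_simps)
  have "mod_seminorm (self_module A) p b = p b"
    using p_nonneg[OF pc, of b] by (simp add: mod_seminorm_def self_module_def p_star_mult[OF pc])
  then have "ereal (mod_seminorm E p (D b)) \<le> op_seminorm (self_module A) E p D"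
    unfolding op_seminorm_def using pb by (intro SUP_upper) simp
  then have "mod_seminorm E p (D b) < d"
    using lt by (meson ereal_less_eq(3) less_ereal.simps(1) order_le_less_trans)
  moreover have "mod_seminorm E p (D b) = mod_seminorm E p (D a) / t"
    unfolding b_def D mod_seminorm_mscale[OF p] norm_of_real using t by simp
  ultimately show ?thesis
    using t by (simp add: t_def[symmetric] pos_divide_less_eq)
qed

lemma openin_adjointables_ball:
  assumes "p \<in> S" "0 < e" "T \<in> adjointables (self_module A) E"
  shows "openin (adjointables_topology A (self_module A) E)
    {R \<in> adjointables (self_module A) E. op_seminorm (self_module A) E p (\<lambda>\<xi>. R \<xi> - T \<xi>) < ereal e}"
  unfolding adjointables_topology_def using assms
  by (intro topology_generated_by_Basis) blast

lemma centre_in_adjointables_ball: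
  assumes "p \<in> S" "0 < e"
  shows "op_seminorm (self_module A) E p (\<lambda>\<xi>. T \<xi> - T \<xi>) < ereal e"
proof -
  have "op_seminorm (self_module A) E p (\<lambda>\<xi>. T \<xi> - T \<xi>) \<le> ereal 0"
    unfolding op_seminorm_def using assms by (intro SUP_least) simp
  then show ?thesis using assms(2) by (meson ereal_less(2) less_ereal.simps(1) order_le_less_trans)
qed

lemma topspace_adjointables_topology:
  "topspace (adjointables_topology A (self_module A) E) = adjointables (self_module A) E"
proof -
  obtain p where p: "p \<in> S" using S_nonempty by blast
  have "adjointables (self_module A) E \<subseteq> topspace (adjointables_topology A (self_module A) E)"
  proof
    fix T assume T: "T \<in> adjointables (self_module A) E"
    show "T \<in> topspace (adjointables_topology A (self_module A) E)"
      by (rule subsetD[OF openin_subset[OF openin_adjointables_ball[OF p zero_less_one T]]],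
          intro CollectI conjI T centre_in_adjointables_ball[OF p zero_less_one])
  qed
  moreover have "topspace (adjointables_topology A (self_module A) E) \<subseteq> adjointables (self_module A) E"
    unfolding adjointables_topology_def topology_generated_by_topspace by blast
  ultimately show ?thesis by blast
qed

lemma multiplier_contraction:
  assumes "h \<in> multiplier_module A E"
  obtains h' g' where "multiplier_pair h' g'"
    "\<And>\<zeta>. ip E \<zeta> \<zeta> - star A (g' \<zeta>) * g' \<zeta> \<in> pos" "range h \<subseteq> range h'"
proof -
  obtain g where hg: "multiplier_pair h g"
    using assms by (rule multiplier_pair_exists)
  obtain Y where Y: "self_adjoint Y" "\<And>a. Y a + g (h (Y a)) = a"
    by (rule multiplier_resolvent[OF hg]) (rule that)
  have B: "self_adjoint (\<lambda>a. g (h a))"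
    by (rule self_adjoint_multiplier[OF hg])
  \<comment> \<open>Self-adjointness of Y and B makes Y a left inverse as well, hence surjective, so
    h and h Y have the same range.\<close>
  have Y': "Y (a + g (h a)) = a" for a
  proof (rule star_mult_left_cancel)
    fix c
    have "star A c * Y (a + g (h a)) = star A (Y c) * (a + g (h a))"
      by (simp add: self_adjointD[OF Y(1)])
    also have "\<dots> = star A (Y c + g (h (Y c))) * a"
      using self_adjointD[OF B, of "Y c" a] by (simp add: distrib_left distrib_right star_add)
    finally show "star A c * Y (a + g (h a)) = star A c * a"
      by (simp add: Y(2))
  qed
  show ?thesis
  proof (rule that)
    show "multiplier_pair (\<lambda>a. h (Y a)) (\<lambda>\<xi>. Y (g \<xi>))"
      by (simp add: multiplier_pair_def multiplier_pair_left[OF hg] self_adjointD[OF Y(1)])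
    show "ip E \<zeta> \<zeta> - star A (Y (g \<zeta>)) * Y (g \<zeta>) \<in> pos" for \<zeta>
      by (rule ip_minus_truncation_pos[OF hg Y(2)])
    show "range h \<subseteq> range (\<lambda>a. h (Y a))"
    proof safe
      fix a
      have "h a = h (Y (a + g (h a)))" by (simp only: Y')
      then show "h a \<in> range (\<lambda>a. h (Y a))" by blast
    qed
  qed
qed

lemma multiplier_pair_comp:
  assumes T: "multiplier_pair T g" and R: "R \<in> adjointables (self_module A) (self_module A)"
  obtains g' where "multiplier_pair (T \<circ> R) g'"
proof -
  obtain R' where R': "\<And>a b. star A (R a) * b = star A a * R' b"
    using R by (auto simp: adjointables_def is_adjoint_def self_module_def)
  have "multiplier_pair (T \<circ> R) (\<lambda>\<xi>. R' (g \<xi>))"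
    by (simp add: multiplier_pair_def multiplier_pair_left[OF T] R')
  then show ?thesis by (rule that)
qed

end

context contraction_sequence
begin

text \<open>The complement is open because evaluation at a fixed a is continuous for the operator
  seminorms and \<open>vanishing\<close> is closed.\<close>

lemma closed_vanishing_multipliers:
  "closed_multiplier_submodule A E {T \<in> multiplier_module A E. \<forall>a. T a \<in> vanishing}"
    (is "closed_multiplier_submodule A E ?N")
  unfolding closed_multiplier_submodule_def
proof (intro conjI ballI allI)
  show "?N \<subseteq> multiplier_module A E" by blast
  show "(\<lambda>a. 0) \<in> ?N"
    by (simp add: vanishing_0 multiplier_module_if_multiplier_pair[OF multiplier_pair_zero])
next
  fix T T' assume T: "T \<in> ?N" and T': "T' \<in> ?N"
  obtain g g' where "multiplier_pair T g" "multiplier_pair T' g'"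
    using T T' multiplier_pair_exists by (metis (no_types, lifting) mem_Collect_eq)
  then show "(\<lambda>a. T a + T' a) \<in> ?N"
    using T T' multiplier_module_if_multiplier_pair[OF multiplier_pair_add]
    by (auto intro: vanishing_add)
next
  fix c T assume T: "T \<in> ?N"
  obtain g where "multiplier_pair T g"
    using T multiplier_pair_exists by (metis (no_types, lifting) mem_Collect_eq)
  then show "(\<lambda>a. mscale E c (T a)) \<in> ?N"
    using T multiplier_module_if_multiplier_pair[OF multiplier_pair_mscale]
    by (auto intro: vanishing_mscale)
next
  fix T R assume T: "T \<in> ?N" and R: "R \<in> adjointables (self_module A) (self_module A)"
  obtain g where "multiplier_pair T g"
    using T multiplier_pair_exists by (metis (no_types, lifting) mem_Collect_eq)
  then obtain g' where "multiplier_pair (T \<circ> R) g'"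
    by (rule multiplier_pair_comp[OF _ R])
  then show "T \<circ> R \<in> ?N"
    using T multiplier_module_if_multiplier_pair by auto
next
  let ?X = "adjointables_topology A (self_module A) E"
  have "openin ?X (topspace ?X - ?N)"
  proof (subst openin_subopen, intro ballI)
    fix T assume T: "T \<in> topspace ?X - ?N"
    then have Tadj: "T \<in> adjointables (self_module A) E" and TM: "T \<in> multiplier_module A E"
      by (simp_all add: topspace_adjointables_topology multiplier_module_def)
    then obtain a where "T a \<notin> vanishing" using T by blast
    then obtain p e where p: "p \<in> S" "e > 0"
      and far: "\<And>\<eta>. \<eta> \<in> vanishing \<Longrightarrow> e \<le> mod_seminorm E p (T a - \<eta>)"
      using vanishing_closed[of "T a"] by (meson not_le)
    \<comment> \<open>By \<open>op_seminorm_bound\<close>, a ball of this radius moves the value at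
      a by less than e.\<close>
    define d where "d = e / (p a + 1)"
    have pa: "0 < p a + 1" using p_nonneg[OF S_cstar[OF p(1)], of a] by simp
    have d: "0 < d" "d * (p a + 1) = e" using p(2) pa by (simp_all add: d_def)
    define U where "U = {R \<in> adjointables (self_module A) E.
      op_seminorm (self_module A) E p (\<lambda>\<xi>. R \<xi> - T \<xi>) < ereal d}"
    have "R \<notin> ?N" if R: "R \<in> U" for R
    proof
      assume RN: "R \<in> ?N"
      obtain g g' where gg: "multiplier_pair T g" "multiplier_pair R g'"
        using TM RN multiplier_pair_exists by (metis (no_types, lifting) mem_Collect_eq)
      have "mod_seminorm E p (R a - T a) < d * (p a + 1)"
      proof (rule op_seminorm_bound[OF p(1), of "\<lambda>\<xi>. R \<xi> - T \<xi>"])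
        show "op_seminorm (self_module A) E p (\<lambda>\<xi>. R \<xi> - T \<xi>) < ereal d"
          using R by (simp add: U_def)
      qed (simp add: multiplier_ascale[OF gg(1)] multiplier_ascale[OF gg(2)] ms.scale_right_diff_distrib)
      moreover have "mod_seminorm E p (R a - T a) = mod_seminorm E p (T a - R a)"
        using mod_seminorm_mscale[OF p(1), of "- 1" "R a - T a"] by simp
      ultimately show False
        using far[of "R a"] RN d(2) by simp
    qed
    moreover have "T \<in> U"
      using Tadj centre_in_adjointables_ball[OF p(1) d(1), of T] by (simp add: U_def)
    moreover have "openin ?X U"
      unfolding U_def by (rule openin_adjointables_ball[OF p(1) d(1) Tadj])
    ultimately show "\<exists>U. openin ?X U \<and> T \<in> U \<and> U \<subseteq> topspace ?X - ?N"
      using openin_subset by blast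
  qed
  then show "closedin ?X ?N"
    unfolding closedin_def
    by (auto simp: topspace_adjointables_topology multiplier_module_def)
qed

text \<open>The embedded generators take values h (a b), so the closed submodule of vanishing
  multipliers contains them and hence the image of E. This yields only the vectors \<xi> a;
  \<open>approximate_unit\<close> and closedness supply \<xi>.\<close>

lemma vanishing_UNIV_if_generating:
  assumes H: "H \<subseteq> multiplier_module A E" "\<And>h a. h \<in> H \<Longrightarrow> h a \<in> vanishing"
    and gen: "generated_closed_submodule A E {multiplier_embed E (h a) | h a. h \<in> H}
      = range (multiplier_embed E)"
  shows "vanishing = UNIV"
proof -
  let ?N = "{T \<in> multiplier_module A E. \<forall>a. T a \<in> vanishing}"
  have "multiplier_embed E (h a) \<in> ?N" if h: "h \<in> H" for h a
  proof -
    obtain g where g: "multiplier_pair h g"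
      using H(1) h multiplier_pair_exists by blast
    have "multiplier_embed E (h a) b = h (a * b)" for b
      by (simp add: multiplier_embed_def multiplier_mult[OF g])
    then show ?thesis
      using H(2)[OF h] multiplier_module_if_multiplier_pair[OF multiplier_pair_embed] by simp
  qed
  then have "range (multiplier_embed E) \<subseteq> ?N"
    unfolding gen[symmetric] generated_closed_submodule_def
    using closed_vanishing_multipliers by blast
  then have act: "act E \<xi> a \<in> vanishing" for \<xi> a
    by (auto simp: multiplier_embed_def)
  have "\<xi> \<in> vanishing" for \<xi>
  proof (rule vanishing_closed)
    fix p and e :: real assume "p \<in> S" "e > 0"
    then obtain a where "mod_seminorm E p (\<xi> - act E \<xi> a) < e"
      by (rule approximate_unit)
    then show "\<exists>\<eta>\<in>vanishing. mod_seminorm E p (\<xi> - \<eta>) < e"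
      using act by blast
  qed
  then show ?thesis by blast
qed

end

lemma infinite_fst_prod_decode: "infinite {j. fst (prod_decode j) = k}"
proof -
  have "range (\<lambda>i. prod_encode (k, i)) \<subseteq> {j. fst (prod_decode j) = k}"
    by auto
  moreover have "infinite (range (\<lambda>i. prod_encode (k, i)))"
    by (rule range_inj_infinite) (auto intro!: injI)
  ultimately show ?thesis
    using finite_subset by blast
qed

lemma (in pre_hilbert_module) normalised_frame_exists:
  assumes "countably_generated_in_multiplier A E"
  shows "\<exists>h. standard_normalised_frame_of_multipliers A E h"
proof -
  obtain H where H: "countable H" "H \<subseteq> multiplier_module A E"
    and gen: "generated_closed_submodule A E {multiplier_embed E (h a) | h a. h \<in> H}
      = range (multiplier_embed E)"
    using assms unfolding countably_generated_in_multiplier_def by blast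
  \<comment> \<open>The zero multiplier makes the set nonempty, so that \<open>from_nat_into\<close>
    enumerates it even for empty H.\<close>
  define H' where "H' = insert (\<lambda>a. 0) H"
  have H'M: "H' \<subseteq> multiplier_module A E"
    using H(2) multiplier_module_if_multiplier_pair[OF multiplier_pair_zero] by (simp add: H'_def)
  have H': "countable H'" "H' \<noteq> {}" using H(1) by (simp_all add: H'_def)
  define gens where "gens = from_nat_into H'"
  have gens: "gens k \<in> multiplier_module A E" for k
    using from_nat_into[OF H'(2)] H'M by (auto simp: gens_def)
  have "\<forall>k. \<exists>h' g'. multiplier_pair h' g' \<and>
      (\<forall>\<zeta>. ip E \<zeta> \<zeta> - star A (g' \<zeta>) * g' \<zeta> \<in> pos) \<and> range (gens k) \<subseteq> range h'"
  proof
    fix k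
    obtain h' g' where "multiplier_pair h' g'"
      "\<And>\<zeta>. ip E \<zeta> \<zeta> - star A (g' \<zeta>) * g' \<zeta> \<in> pos" "range (gens k) \<subseteq> range h'"
      by (rule multiplier_contraction[OF gens[of k]]) (rule that)
    then show "\<exists>h' g'. multiplier_pair h' g' \<and>
      (\<forall>\<zeta>. ip E \<zeta> \<zeta> - star A (g' \<zeta>) * g' \<zeta> \<in> pos) \<and> range (gens k) \<subseteq> range h'"
      by blast
  qed
  then obtain h' g' where "\<forall>k. multiplier_pair (h' k) (g' k) \<and>
      (\<forall>\<zeta>. ip E \<zeta> \<zeta> - star A (g' k \<zeta>) * g' k \<zeta> \<in> pos) \<and> range (gens k) \<subseteq> range (h' k)"
    unfolding choice_iff by blast
  then have hg: "multiplier_pair (h' k) (g' k)" "ip E \<zeta> \<zeta> - star A (g' k \<zeta>) * g' k \<zeta> \<in> pos"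
    "range (gens k) \<subseteq> range (h' k)" for k \<zeta>
    by blast+
  \<comment> \<open>First components of decoded pairs take every value infinitely often.\<close>
  define \<phi> where "\<phi> j = fst (prod_decode j)" for j
  interpret C: contraction_sequence A E "\<lambda>j. h' (\<phi> j)" "\<lambda>j. g' (\<phi> j)"
    by unfold_locales (rule hg)+
  have "h a \<in> C.vanishing" if h: "h \<in> H" for h a
  proof -
    obtain k where k: "h = gens k"
      using from_nat_into_surj[OF H'(1), of h] h by (auto simp: gens_def H'_def)
    obtain b where b: "h a = h' k b"
      using hg(3)[of k] k by blast
    show ?thesis
      unfolding b
      by (rule C.vanishing_repeated[OF infinite_fst_prod_decode[of k] _ hg(1)]) (simp add: \<phi>_def)
  qed
  then have "C.vanishing = UNIV"
    using H(2) gen by (intro C.vanishing_UNIV_if_generating)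
  then show ?thesis
    using C.normalised_frame_if_vanishing by blast
qed

theorem proposition3p6:
  fixes A :: "'a::{ring, uniform_space, t2_space} star_alg"
    and E :: "('a, 'e::{ab_group_add, uniform_space}) ip_module"
  assumes "pro_cstar_algebra A"
    and "hilbert_module A E"
    and "countably_generated_in_multiplier A E"
  shows "\<exists>h. standard_normalised_frame_of_multipliers A E h"
proof -
  interpret hilbert_module A E by fact
  show ?thesis using assms(3) by (rule normalised_frame_exists)
qed

end
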